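(* Let $G$ be a compact group with normalized Haar measure $m_G$, let $X$ be a complex Banach space, let $\Phi$ be a Young function, and let $\nu$ be an $X$-valued vector measure on $G$ which is absolutely continuous with respect to $m_G$ and norm integral translation invariant. Then the Orlicz space $L^\Phi(\nu)$ is a homogeneous space; that is, for each $f\in L^\Phi(\nu)$ and $s\in G$: (i) $\tau_s f\in L^\Phi(\nu)$; (ii) $\|\tau_s f\|_{\nu,\Phi}=\|f\|_{\nu,\Phi}$; and (iii) the map $s\mapsto \tau_s f$ is continuous from $G$ into $L^\Phi(\nu)$.
   Context: $\mathcal{B}(G)$ is the Borel $\sigma$-algebra of the compact group $G$, and $m_G$ is the normalized Haar measure. A vector measure $\nu$ is a $\sigma$-additive map $\mathcal{B}(G)\to X$, with $X$ a complex Banach space. $X'$ is the topological dual of $X$, $B_{X'}$ its closed unit ball; for $x'\in X'$, $\langle\nu,x'\rangle(A)=\langle\nu(A),x'\rangle$ is a complex measure with total variation $|\langle\nu,x'\rangle|$. $\nu$ is absolutely continuous w.r.t. $m_G$ (written $\nu\in M_{ac}(G,X)$) if $\nu(A)\to0$ as $m_G(A)\to 0$. A set $A$ is $\nu$-null if $\nu(B)=0$ for all Borel $B\subset A$; functions equal off a $\nu$-null set are identified. $\tau_s f(t)=f(s^{-1}t)$. For a simple function $\phi=\sum_i\alpha_i\chi_{A_i}$, $I_\nu(\phi)=\int_G\phi\,d\nu=\sum_i\alpha_i\nu(A_i)$. $\nu$ is norm integral translation invariant if $\|I_\nu(\tau_s\phi)\|=\|I_\nu(\phi)\|$ for every simple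 function $\phi$ on $G$ and every $s\in G$. A Young function is a strictly increasing, convex, continuous $\Phi:[0,\infty)\to[0,\infty)$ with $\Phi(t)=0$ iff $t=0$ and $\lim_{t\to\infty}\Phi(t)=\infty$. For a finite positive measure $\mu$, $\|f\|_{L^\Phi(\mu)}=\inf\{k>0:\int_G\Phi(|f|/k)\,d\mu\le 1\}$. $L^\Phi_w(\nu)$ is the space of complex measurable $f$ with $\|f\|_{\nu,\Phi}=\sup_{x'\in B_{X'}}\|f\|_{L^\Phi(|\langle\nu,x'\rangle|)}<\infty$, and $L^\Phi(\nu)$ is the closure of the simple functions in it under $\|\cdot\|_{\nu,\Phi}$. *)

theory Defs
  imports "HOL-Analysis.Analysis"
begin

section \<open>Complex Banach spaces\<close>

class complex_banach = banach +
  fixes scaleC :: "complex \<Rightarrow> 'a \<Rightarrow> 'a"  (infixr "*\<^sub>C" 75)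
  assumes scaleC_add_right: "c *\<^sub>C (x + y) = c *\<^sub>C x + c *\<^sub>C y"
    and scaleC_add_left: "(c + d) *\<^sub>C x = c *\<^sub>C x + d *\<^sub>C x"
    and scaleC_scaleC: "c *\<^sub>C d *\<^sub>C x = (c * d) *\<^sub>C x"
    and scaleR_scaleC: "r *\<^sub>R x = complex_of_real r *\<^sub>C x"
    and norm_scaleC: "norm (c *\<^sub>C x) = cmod c * norm x"

text \<open>The closed unit ball of the topological dual, that is, of the space of
  continuous complex-linear functionals with the operator norm.\<close>

definition dual_ball :: "('x::complex_banach \<Rightarrow> complex) set" where
  "dual_ball = {x'. bounded_linear x' \<and> (\<forall>c x. x' (c *\<^sub>C x) = c * x' x) \<and> onorm x' \<le> 1}"


section \<open>Compact groups\<close>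

text \<open>The library class of topological groups is written additively but does not assume
  commutativity: the product \<open>s t\<close> is \<open>s + t\<close>, and \<open>s\<^sup>-\<^sup>1 t\<close> is \<open>- s + t\<close> (in this order).
  A compact group is understood to be Hausdorff.\<close>

definition translate :: "'g::group_add \<Rightarrow> ('g \<Rightarrow> 'a) \<Rightarrow> 'g \<Rightarrow> 'a" where
  "translate s f = (\<lambda>t. f (- s + t))"

text \<open>Normalized Haar measure: the left-invariant Radon probability measure on the Borel sets.\<close>

definition normalized_haar_measure :: "'g::topological_group_add measure \<Rightarrow> bool" where
  "normalized_haar_measure m \<longleftrightarrow>
     sets m = sets borel \<and>
     emeasure m UNIV = 1 \<and>
     (\<forall>s. \<forall>A\<in>sets borel. emeasure m ((\<lambda>t. s + t) ` A) = emeasure m A) \<and>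
     (\<forall>A\<in>sets borel. emeasure m A = (INF U\<in>{U. open U \<and> A \<subseteq> U}. emeasure m U)) \<and>
     (\<forall>U. open U \<longrightarrow> emeasure m U = (SUP K\<in>{K. compact K \<and> K \<subseteq> U}. emeasure m K))"


section \<open>Vector measures\<close>

text \<open>Only the values of a set function on Borel sets are relevant in what follows.\<close>

definition vector_measure :: "('g::topological_space set \<Rightarrow> 'x::real_normed_vector) \<Rightarrow> bool" where
  "vector_measure \<nu> \<longleftrightarrow>
     (\<forall>A::nat \<Rightarrow> 'g set. range A \<subseteq> sets borel \<longrightarrow> disjoint_family A \<longrightarrow>
        (\<lambda>n. \<nu> (A n)) sums \<nu> (\<Union>n. A n))"

definition absolutely_continuous_vm ::
    "('g::topological_space set \<Rightarrow> 'x::real_normed_vector) \<Rightarrow> 'g measure \<Rightarrow> bool" where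
  "absolutely_continuous_vm \<nu> m \<longleftrightarrow>
     (\<forall>\<epsilon>>0. \<exists>\<delta>>0. \<forall>A\<in>sets borel. measure m A < \<delta> \<longrightarrow> norm (\<nu> A) < \<epsilon>)"

definition vm_null :: "('g::topological_space set \<Rightarrow> 'x::zero) \<Rightarrow> 'g set \<Rightarrow> bool" where
  "vm_null \<nu> A \<longleftrightarrow> A \<in> sets borel \<and> (\<forall>B\<in>sets borel. B \<subseteq> A \<longrightarrow> \<nu> B = 0)"

text \<open>The integral of a simple function, through its canonical representation (as in
  \<^const>\<open>simple_integral\<close>).\<close>

definition vm_simple_integral ::
    "('g set \<Rightarrow> 'x::complex_banach) \<Rightarrow> ('g \<Rightarrow> complex) \<Rightarrow> 'x" where
  "vm_simple_integral \<nu> \<phi> = (\<Sum>\<alpha>\<in>range \<phi>. \<alpha> *\<^sub>C \<nu> (\<phi> -` {\<alpha>}))"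

definition norm_integral_translation_invariant ::
    "('g::topological_group_add set \<Rightarrow> 'x::complex_banach) \<Rightarrow> bool" where
  "norm_integral_translation_invariant \<nu> \<longleftrightarrow>
     (\<forall>\<phi> s. simple_function borel \<phi> \<longrightarrow>
        norm (vm_simple_integral \<nu> (translate s \<phi>)) = norm (vm_simple_integral \<nu> \<phi>))"

definition total_variation :: "('g::topological_space set \<Rightarrow> complex) \<Rightarrow> 'g set \<Rightarrow> ennreal" where
  "total_variation \<mu> A =
     (SUP P\<in>{P. finite P \<and> P \<subseteq> sets borel \<and> partition_on A P}. \<Sum>B\<in>P. ennreal (cmod (\<mu> B)))"

definition variation_measure :: "('g::topological_space set \<Rightarrow> complex) \<Rightarrow> 'g measure" where
  "variation_measure \<mu> = measure_of UNIV (sets borel) (total_variation \<mu>)"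


subsection \<open>The total variation of a complex measure is a measure\<close>

text \<open>Consequently \<^const>\<open>measure_of\<close> does not fall back to the zero measure in
  \<^const>\<open>variation_measure\<close>.\<close>

lemma vector_measure_empty:
  assumes "vector_measure \<nu>"
  shows "\<nu> {} = 0"
proof -
  have "(\<lambda>n::nat. \<nu> {}) sums \<nu> (\<Union>n::nat. {})"
    using assms unfolding vector_measure_def
    by (elim allE[where x = "\<lambda>_. {}"]) (auto simp: disjoint_family_on_def)
  then show ?thesis
    using sums_summable summable_const_iff by blast
qed

lemma norm_sums_le_suminf_ennreal:
  assumes "f sums (a::'a::real_normed_vector)"
  shows "ennreal (norm a) \<le> (\<Sum>n. ennreal (norm (f n)))"
proof -
  have "(\<lambda>n. ennreal (norm (\<Sum>i<n. f i))) \<longlonglongrightarrow> ennreal (norm a)"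
    using assms unfolding sums_def by (intro tendsto_ennrealI tendsto_norm)
  moreover have "ennreal (norm (\<Sum>i<n. f i)) \<le> (\<Sum>n. ennreal (norm (f n)))" for n
  proof -
    have "ennreal (norm (\<Sum>i<n. f i)) \<le> ennreal (\<Sum>i<n. norm (f i))"
      by (intro ennreal_leI norm_sum)
    also have "\<dots> = (\<Sum>i<n. ennreal (norm (f i)))"
      by (simp add: sum_ennreal)
    also have "\<dots> \<le> (\<Sum>n. ennreal (norm (f n)))"
      by (intro sum_le_suminf) auto
    finally show ?thesis .
  qed
  ultimately show ?thesis
    by (intro LIMSEQ_le_const2[where X = "\<lambda>n. ennreal (norm (\<Sum>i<n. f i))"]) auto
qed

lemma total_variation_superadditive:
  assumes "A \<in> sets borel" "B \<in> sets borel" "A \<inter> B = {}"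
  shows "total_variation \<mu> A + total_variation \<mu> B \<le> total_variation \<mu> (A \<union> B)"
proof -
  let ?S = "\<lambda>A. {P. finite P \<and> P \<subseteq> sets borel \<and> partition_on A P}"
  let ?f = "\<lambda>P. \<Sum>C\<in>P. ennreal (cmod (\<mu> C))"
  have ne: "?S C \<noteq> {}" if "C \<in> sets borel" for C
  proof -
    have "{C} - {{}} \<in> ?S C"
      using that by (auto simp: partition_on_def pairwise_def)
    then show ?thesis by blast
  qed
  have "?f P + ?f Q \<le> total_variation \<mu> (A \<union> B)" if P: "P \<in> ?S A" and Q: "Q \<in> ?S B" for P Q
  proof -
    have sub: "\<And>C. C \<in> P \<Longrightarrow> C \<subseteq> A \<and> C \<noteq> {}" "\<And>C. C \<in> Q \<Longrightarrow> C \<subseteq> B \<and> C \<noteq> {}"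
      using P Q by (auto simp: partition_on_def)
    have disj: "P \<inter> Q = {}"
      using sub assms(3) by blast
    have "disjoint (P \<union> Q)"
      using P Q assms(3) unfolding partition_on_def by (intro disjoint_union) auto
    then have "P \<union> Q \<in> ?S (A \<union> B)"
      using P Q by (auto simp: partition_on_def)
    then have "?f (P \<union> Q) \<le> total_variation \<mu> (A \<union> B)"
      unfolding total_variation_def by (intro SUP_upper)
    moreover have "?f (P \<union> Q) = ?f P + ?f Q"
      using P Q disj by (intro sum.union_disjoint) auto
    ultimately show ?thesis by simp
  qed
  then have "(SUP P\<in>?S A. SUP Q\<in>?S B. ?f P + ?f Q) \<le> total_variation \<mu> (A \<union> B)"
    by (intro SUP_least)
  also have "(SUP P\<in>?S A. SUP Q\<in>?S B. ?f P + ?f Q) = total_variation \<mu> A + total_variation \<mu> B"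
    unfolding total_variation_def
    by (simp only: ennreal_SUP_add_left[OF ne[OF assms(1)]] ennreal_SUP_add_right[OF ne[OF assms(2)], symmetric])
  finally show ?thesis .
qed

lemma total_variation_mono:
  assumes "A \<in> sets borel" "B \<in> sets borel" "A \<subseteq> B"
  shows "total_variation \<mu> A \<le> total_variation \<mu> B"
proof -
  have "total_variation \<mu> A \<le> total_variation \<mu> A + total_variation \<mu> (B - A)"
    by simp
  also have "\<dots> \<le> total_variation \<mu> (A \<union> (B - A))"
    using assms by (intro total_variation_superadditive) auto
  also have "A \<union> (B - A) = B"
    using assms by auto
  finally show ?thesis .
qed

lemma total_variation_empty: "total_variation \<mu> {} = 0"
  unfolding total_variation_def by (auto simp: partition_on_empty SUP_eq_iff bot_ennreal)

lemma total_variation_subadditive: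
  assumes \<mu>: "vector_measure \<mu>" and A: "range A \<subseteq> sets borel" "disjoint_family A"
  shows "total_variation \<mu> (\<Union>i::nat. A i) \<le> (\<Sum>i. total_variation \<mu> (A i))"
  unfolding total_variation_def[of _ "\<Union>i. A i"]
proof (rule SUP_least)
  fix P assume "P \<in> {P. finite P \<and> P \<subseteq> sets borel \<and> partition_on (\<Union>i. A i) P}"
  then have P: "finite P" "P \<subseteq> sets borel" "partition_on (\<Union>i. A i) P"
    by auto
  have 1: "ennreal (cmod (\<mu> B)) \<le> (\<Sum>i. ennreal (cmod (\<mu> (A i \<inter> B))))" if "B \<in> P" for B
  proof -
    have "(\<lambda>i. \<mu> (A i \<inter> B)) sums \<mu> (\<Union>i. A i \<inter> B)"
      using \<mu> A P(2) that unfolding vector_measure_def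
      by (elim allE[where x = "\<lambda>i. A i \<inter> B"]) (auto simp: disjoint_family_on_def)
    moreover have "(\<Union>i. A i \<inter> B) = B"
      using P(3) that by (auto simp: partition_on_def)
    ultimately show ?thesis
      using norm_sums_le_suminf_ennreal by fastforce
  qed
  have 2: "(\<Sum>B\<in>P. ennreal (cmod (\<mu> (A i \<inter> B)))) \<le> total_variation \<mu> (A i)" for i
  proof -
    let ?Q = "(\<inter>) (A i) ` P - {{}}"
    have "partition_on (A i \<inter> (\<Union>i. A i)) ?Q"
      by (rule partition_on_restrict[OF P(3)])
    moreover have "A i \<inter> (\<Union>i. A i) = A i"
      by auto
    ultimately have "?Q \<in> {P. finite P \<and> P \<subseteq> sets borel \<and> partition_on (A i) P}"
      using P(1,2) A(1) by auto
    then have *: "(\<Sum>C\<in>?Q. ennreal (cmod (\<mu> C))) \<le> total_variation \<mu> (A i)"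
      unfolding total_variation_def by (intro SUP_upper)
    have "(\<Sum>C\<in>(\<inter>) (A i) ` P. ennreal (cmod (\<mu> C))) = (\<Sum>B\<in>P. ennreal (cmod (\<mu> (A i \<inter> B))))"
    proof (rule sum.reindex_nontrivial[OF P(1), unfolded o_def])
      fix B C assume BC: "B \<in> P" "C \<in> P" "B \<noteq> C" "A i \<inter> B = A i \<inter> C"
      then have "B \<inter> C = {}"
        using P(3) by (auto simp: partition_on_def disjoint_def)
      then have "A i \<inter> B = {}"
        using BC(4) by blast
      then show "ennreal (cmod (\<mu> (A i \<inter> B))) = 0"
        using vector_measure_empty[OF \<mu>] by simp
    qed
    moreover have "(\<Sum>C\<in>(\<inter>) (A i) ` P. ennreal (cmod (\<mu> C))) = (\<Sum>C\<in>?Q. ennreal (cmod (\<mu> C)))"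
      using P(1) vector_measure_empty[OF \<mu>] by (intro sum.mono_neutral_right) auto
    ultimately show ?thesis
      using * by simp
  qed
  have "(\<Sum>B\<in>P. ennreal (cmod (\<mu> B))) \<le> (\<Sum>B\<in>P. \<Sum>i. ennreal (cmod (\<mu> (A i \<inter> B))))"
    by (intro sum_mono 1)
  also have "\<dots> = (\<Sum>i. \<Sum>B\<in>P. ennreal (cmod (\<mu> (A i \<inter> B))))"
    by (rule suminf_sum[symmetric]) auto
  also have "\<dots> \<le> (\<Sum>i. total_variation \<mu> (A i))"
    by (intro suminf_le 2) auto
  finally show "(\<Sum>B\<in>P. ennreal (cmod (\<mu> B))) \<le> (\<Sum>i. total_variation \<mu> (A i))" .
qed

lemma total_variation_countably_additive:
  assumes \<mu>: "vector_measure \<mu>"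
  shows "countably_additive (sets borel) (total_variation \<mu>)"
proof (rule countably_additiveI)
  fix A :: "nat \<Rightarrow> 'a set"
  assume A: "range A \<subseteq> sets borel" "disjoint_family A" "(\<Union>i. A i) \<in> sets borel"
  have fin: "(\<Sum>i<n. total_variation \<mu> (A i)) \<le> total_variation \<mu> (\<Union>i<n. A i)" for n
  proof (induction n)
    case (Suc n)
    have "(\<Sum>i<Suc n. total_variation \<mu> (A i))
        \<le> total_variation \<mu> (\<Union>i<n. A i) + total_variation \<mu> (A n)"
      using Suc.IH by (simp add: add_right_mono)
    also have "\<dots> \<le> total_variation \<mu> ((\<Union>i<n. A i) \<union> A n)"
    proof (rule total_variation_superadditive)
      show "(\<Union>i<n. A i) \<inter> A n = {}"
      proof -
        have "A i \<inter> A n = {}" if "i < n" for i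
          using A(2) that by (auto simp: disjoint_family_on_def)
        then show ?thesis by blast
      qed
    qed (use A(1) in auto)
    also have "(\<Union>i<n. A i) \<union> A n = (\<Union>i<Suc n. A i)"
      by (auto simp: less_Suc_eq)
    finally show ?case .
  qed (simp add: total_variation_empty)
  have "(\<Sum>i<n. total_variation \<mu> (A i)) \<le> total_variation \<mu> (\<Union>i. A i)" for n
    by (rule order_trans[OF fin total_variation_mono]) (use A in auto)
  then have "(\<Sum>i. total_variation \<mu> (A i)) \<le> total_variation \<mu> (\<Union>i. A i)"
    by (simp add: suminf_eq_SUP SUP_le_iff)
  with total_variation_subadditive[OF \<mu> A(1,2)]
  show "(\<Sum>i. total_variation \<mu> (A i)) = total_variation \<mu> (\<Union>i. A i)"
    by (rule antisym[rotated])
qed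

lemma sets_variation_measure: "sets (variation_measure \<mu>) = sets borel"
  unfolding variation_measure_def
  using sets.sets_measure_of_eq[of borel] by simp

lemma emeasure_variation_measure:
  assumes "vector_measure \<mu>" "A \<in> sets borel"
  shows "emeasure (variation_measure \<mu>) A = total_variation \<mu> A"
  using assms total_variation_countably_additive[OF assms(1)]
  by (intro emeasure_measure_of[OF variation_measure_def])
     (auto simp: sets_variation_measure positive_def total_variation_empty)


section \<open>Orlicz spaces of a vector measure\<close>

definition young_function :: "(real \<Rightarrow> real) \<Rightarrow> bool" where
  "young_function \<Phi> \<longleftrightarrow>
     (\<forall>t\<ge>0. 0 \<le> \<Phi> t) \<and> strict_mono_on {0..} \<Phi> \<and> convex_on {0..} \<Phi> \<and> continuous_on {0..} \<Phi> \<and>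
     (\<forall>t\<ge>0. \<Phi> t = 0 \<longleftrightarrow> t = 0) \<and> filterlim \<Phi> at_top at_top"

text \<open>The infimum is taken in \<^typ>\<open>ennreal\<close>, so that it is \<open>\<infinity>\<close> if no \<open>k\<close> is admissible.\<close>

definition luxemburg_norm :: "(real \<Rightarrow> real) \<Rightarrow> 'g measure \<Rightarrow> ('g \<Rightarrow> complex) \<Rightarrow> ennreal" where
  "luxemburg_norm \<Phi> \<mu> f =
     (INF k\<in>{k::real. 0 < k \<and> (\<integral>\<^sup>+t. ennreal (\<Phi> (cmod (f t) / k)) \<partial>\<mu>) \<le> 1}. ennreal k)"

definition orlicz_norm ::
    "(real \<Rightarrow> real) \<Rightarrow> ('g::topological_space set \<Rightarrow> 'x::complex_banach) \<Rightarrow> ('g \<Rightarrow> complex) \<Rightarrow> ennreal" where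
  "orlicz_norm \<Phi> \<nu> f =
     (SUP x'\<in>dual_ball. luxemburg_norm \<Phi> (variation_measure (\<lambda>A. x' (\<nu> A))) f)"

text \<open>Elements of the Orlicz spaces are represented by Borel functions; identified functions are
  those related by \<open>vm_ae_eq\<close>, and topological notions refer to the seminorm
  \<^const>\<open>orlicz_norm\<close>.\<close>

definition vm_ae_eq ::
    "('g::topological_space set \<Rightarrow> 'x::zero) \<Rightarrow> ('g \<Rightarrow> complex) \<Rightarrow> ('g \<Rightarrow> complex) \<Rightarrow> bool" where
  "vm_ae_eq \<nu> f g \<longleftrightarrow> vm_null \<nu> {t. f t \<noteq> g t}"

definition weak_orlicz_space ::
    "(real \<Rightarrow> real) \<Rightarrow> ('g::topological_space set \<Rightarrow> 'x::complex_banach) \<Rightarrow> ('g \<Rightarrow> complex) set" where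
  "weak_orlicz_space \<Phi> \<nu> = {f. f \<in> borel_measurable borel \<and> orlicz_norm \<Phi> \<nu> f < \<infinity>}"

definition orlicz_space ::
    "(real \<Rightarrow> real) \<Rightarrow> ('g::topological_space set \<Rightarrow> 'x::complex_banach) \<Rightarrow> ('g \<Rightarrow> complex) set" where
  "orlicz_space \<Phi> \<nu> =
     {f \<in> weak_orlicz_space \<Phi> \<nu>.
        \<forall>\<epsilon>>0. \<exists>\<phi>. simple_function borel \<phi> \<and> orlicz_norm \<Phi> \<nu> (\<lambda>t. f t - \<phi> t) < \<epsilon>}"

end

theory Submission
  imports Defs
begin

text \<open>The difficulty is that the Orlicz norm is a supremum over functionals \<open>x'\<close> of norms for the scalar
  measures \<open>\<langle>\<nu>, x'\<rangle>\<close>, whereas the invariance hypothesis concerns only norms of integrals in \<open>X\<close>. The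
  two are connected by duality. By the hypothesis, \<open>I\<^sub>\<nu> \<phi> \<mapsto> I\<^sub>\<nu> (\<tau>\<^sub>s \<phi>)\<close> is a linear isometry of the range
  of \<open>I\<^sub>\<nu>\<close> on simple functions. Composing \<open>x'\<close> with this isometry and extending by the Hahn--Banach
  theorem gives \<open>y'\<close> in the dual ball with \<open>\<langle>\<nu> (s A), x'\<rangle> = \<langle>\<nu> A, y'\<rangle>\<close> for all Borel sets \<open>A\<close>
  (\<open>translated_functional\<close>). Hence the variation of \<open>\<langle>\<nu>, y'\<rangle>\<close> is the image of that of \<open>\<langle>\<nu>, x'\<rangle>\<close>
  under the translation by \<open>s\<^sup>-\<^sup>1\<close>, the norm of \<open>\<tau>\<^sub>s f\<close> seen by \<open>x'\<close> is the norm of \<open>f\<close> seen by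
  \<open>y'\<close>, and taking suprema shows that the Orlicz norm is translation invariant
  (\<open>orlicz_norm_translate\<close>). Since translates of simple functions are simple, the Orlicz space is
  invariant as well.

  For continuity, invariance of the norm and density of the simple functions leave only the case of
  a simple function and of \<open>s\<close> tending to the neutral element. There \<open>\<tau>\<^sub>s \<phi> - \<phi>\<close> is bounded, and it is
  supported on a set whose Haar measure tends to zero by regularity
  (\<open>haar_measure_translation_diff\<close>). Absolute continuity turns this into smallness of all
  variations at once: the variation of \<open>\<langle>\<nu>, x'\<rangle>\<close> on \<open>D\<close> is at most four times the supremum of
  \<open>\<parallel>\<nu> C\<parallel>\<close> over Borel sets \<open>C \<subseteq> D\<close>, a bound that does not involve \<open>x'\<close>
  (\<open>total_variation_le\<close>, \<open>orlicz_norm_small_support\<close>).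

  The Hahn--Banach theorem is derived from the fact that a minimal sublinear functional is linear.\<close>

section \<open>The Hahn--Banach theorem\<close>

text \<open>Positive homogeneity is required only as an inequality. It is then an equality, by
  scaling back, and the inequality is what survives pointwise infima.\<close>

definition sublinear :: "('a::real_vector \<Rightarrow> real) \<Rightarrow> bool" where
  "sublinear p \<longleftrightarrow> (\<forall>x y. p (x + y) \<le> p x + p y) \<and> (\<forall>c x. 0 < c \<longrightarrow> p (c *\<^sub>R x) \<le> c * p x)"

lemma sublinear_add: "sublinear p \<Longrightarrow> p (x + y) \<le> p x + p y"
  and sublinear_scale_le: "sublinear p \<Longrightarrow> 0 < c \<Longrightarrow> p (c *\<^sub>R x) \<le> c * p x"
  by (auto simp: sublinear_def)

lemma sublinear_zero: "sublinear p \<Longrightarrow> p 0 = 0"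
  using sublinear_scale_le[of p 2 0] sublinear_scale_le[of p "1/2" 0] by simp

lemma sublinear_scale:
  assumes "sublinear p" "0 < c"
  shows "p (c *\<^sub>R x) = c * p x"
proof -
  have "p (inverse c *\<^sub>R c *\<^sub>R x) \<le> inverse c * p (c *\<^sub>R x)"
    using assms by (intro sublinear_scale_le) auto
  then have "c * p x \<le> p (c *\<^sub>R x)"
    using assms(2) by (simp add: field_simps)
  with sublinear_scale_le[OF assms, of x] show ?thesis by simp
qed

lemma sublinear_ge_neg:
  assumes "sublinear p"
  shows "- p (- x) \<le> p x"
  using sublinear_add[OF assms, of x "- x"] sublinear_zero[OF assms] by simp

text \<open>The infimum of a family is sublinear if the family is closed, up to domination, under the two
  operations; the index on the left may depend on the arguments. This covers three constructions
  below: the infimum of a chain, the infimum over a ray, and the infimal convolution of the norm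
  with a functional on a subspace.\<close>

lemma sublinear_INF:
  assumes ne: "I \<noteq> {}" and bdd: "\<And>x. bdd_below ((\<lambda>i. h i x) ` I)"
    and add: "\<And>i j x y. i \<in> I \<Longrightarrow> j \<in> I \<Longrightarrow> \<exists>k\<in>I. h k (x + y) \<le> h i x + h j y"
    and scale: "\<And>i c x. i \<in> I \<Longrightarrow> 0 < c \<Longrightarrow> \<exists>k\<in>I. h k (c *\<^sub>R x) \<le> c * h i x"
  shows "sublinear (\<lambda>x. INF i\<in>I. h i x)"
  unfolding sublinear_def
proof (intro conjI allI impI)
  let ?q = "\<lambda>x. INF i\<in>I. h i x"
  have lower: "?q x \<le> h i x" if "i \<in> I" for i x
    using cINF_lower[OF bdd that] .
  fix x y
  have le: "?q (x + y) \<le> h i x + h j y" if "i \<in> I" "j \<in> I" for i j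
    using add[OF that, of x y] lower order_trans by blast
  have "?q (x + y) - h j y \<le> ?q x" if "j \<in> I" for j
    using le[OF _ that] by (intro cINF_greatest[OF ne]) (simp add: algebra_simps)
  then have "?q (x + y) - ?q x \<le> ?q y"
    by (intro cINF_greatest[OF ne]) (simp add: algebra_simps)
  then show "?q (x + y) \<le> ?q x + ?q y" by simp
next
  let ?q = "\<lambda>x. INF i\<in>I. h i x"
  fix c :: real and x
  assume c: "0 < c"
  have "?q (c *\<^sub>R x) / c \<le> h i x" if i: "i \<in> I" for i
  proof -
    obtain k where k: "k \<in> I" "h k (c *\<^sub>R x) \<le> c * h i x"
      using scale[OF i c] by blast
    have "?q (c *\<^sub>R x) \<le> h k (c *\<^sub>R x)"
      using cINF_lower[OF bdd k(1)] .
    with k(2) c show ?thesis by (simp add: field_simps)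
  qed
  then have "?q (c *\<^sub>R x) / c \<le> ?q x"
    by (intro cINF_greatest[OF ne])
  with c show "?q (c *\<^sub>R x) \<le> c * ?q x" by (simp add: field_simps)
qed

text \<open>For each \<open>y\<close>, the infimum over \<open>t \<ge> 0\<close> of \<open>q (x + t y) - t q y\<close> is again sublinear in \<open>x\<close> and lies
  below \<open>q\<close>. By minimality it equals \<open>q\<close>, and its term at \<open>t = 1\<close> shows that \<open>q\<close> is superadditive.\<close>

lemma minimal_sublinear_is_linear:
  assumes q: "sublinear q" and min: "\<And>r. sublinear r \<Longrightarrow> r \<le> q \<Longrightarrow> r = q"
  shows "linear q"
proof -
  have super: "q x + q y \<le> q (x + y)" for x y
  proof -
    let ?h = "\<lambda>t x. q (x + t *\<^sub>R y) - t * q y"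
    let ?r = "\<lambda>x. INF t\<in>{0..}. ?h t x"
    have bdd: "bdd_below ((\<lambda>t. ?h t x) ` {0..})" for x
    proof (rule bdd_belowI2[where m = "- q (- x)"])
      fix t :: real assume t: "t \<in> {0..}"
      have "t * q y = q (t *\<^sub>R y)"
        using t sublinear_scale[OF q, of t y] sublinear_zero[OF q] by (cases "t = 0") auto
      also have "\<dots> \<le> q (x + t *\<^sub>R y) + q (- x)"
        using sublinear_add[OF q, of "x + t *\<^sub>R y" "- x"] by simp
      finally show "- q (- x) \<le> ?h t x" by simp
    qed
    have "sublinear ?r"
    proof (rule sublinear_INF)
      fix s t :: real and x z assume st: "s \<in> {0..}" "t \<in> {0..}"
      have "?h (s + t) (x + z) \<le> ?h s x + ?h t z"
        using sublinear_add[OF q, of "x + s *\<^sub>R y" "z + t *\<^sub>R y"] by (simp add: algebra_simps)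
      then show "\<exists>k\<in>{0..}. ?h k (x + z) \<le> ?h s x + ?h t z"
        using st by (intro bexI[of _ "s + t"]) auto
    next
      fix t c :: real and x assume tc: "t \<in> {0..}" "0 < c"
      have "?h (c * t) (c *\<^sub>R x) \<le> c * ?h t x"
        using sublinear_scale_le[OF q tc(2), of "x + t *\<^sub>R y"] by (simp add: algebra_simps)
      then show "\<exists>k\<in>{0..}. ?h k (c *\<^sub>R x) \<le> c * ?h t x"
        using tc by (intro bexI[of _ "c * t"]) auto
    qed (use bdd in auto)
    moreover have "?r \<le> q"
      using cINF_lower[OF bdd, of 0] by (auto intro!: le_funI)
    ultimately have "?r = q" by (rule min)
    then have "q x \<le> ?h 1 x"
      using cINF_lower[OF bdd, of 1 x] by (auto dest: fun_cong[where x = x])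
    then show ?thesis by simp
  qed
  have add: "q (x + y) = q x + q y" for x y
    using super sublinear_add[OF q] by (simp add: antisym)
  have neg: "q (- x) = - q x" for x
    using add[of x "- x"] sublinear_zero[OF q] by simp
  show ?thesis
  proof
    fix c :: real and x
    have "q (c *\<^sub>R x) = c * q x" if "c < 0"
      using sublinear_scale[OF q, of "- c" x] neg[of "c *\<^sub>R x"] that by simp
    then show "q (c *\<^sub>R x) = c *\<^sub>R q x"
      using sublinear_scale[OF q, of c x] sublinear_zero[OF q]
      by (cases c "0::real" rule: linorder_cases) auto
  qed (rule add)
qed

text \<open>Zorn's lemma applied downwards: every chain of sublinear functionals below \<open>p\<close> has its
  pointwise infimum as a lower bound, the value at \<open>x\<close> being bounded below by \<open>- p (- x)\<close>.
  A minimal element is linear. Since all functionals live on the whole space, no partially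
  defined extensions have to be handled.\<close>

theorem linear_below_sublinear:
  assumes p: "sublinear p"
  obtains F where "linear F" "\<And>x. F x \<le> p x"
proof -
  let ?A = "{f. sublinear f \<and> f \<le> p}"
  let ?P = "\<lambda>f g. g \<le> (f :: 'a \<Rightarrow> real)"
  have "\<exists>q\<in>?A. \<forall>r\<in>?A. ?P q r \<longrightarrow> r = q"
  proof (rule predicate_Zorn)
    show "partial_order_on ?A (relation_of ?P ?A)"
      by (auto simp: partial_order_on_def preorder_on_def refl_on_def trans_def antisym_def
          relation_of_def)
    fix C assume C: "C \<in> Chains (relation_of ?P ?A)"
    show "\<exists>u\<in>?A. \<forall>a\<in>C. ?P a u"
    proof (cases "C = {}")
      case True then show ?thesis using p by auto
    next
      case False
      have sub: "sublinear f" "f \<le> p" if "f \<in> C" for f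
        using C that by (auto simp: Chains_def relation_of_def)
      have tot: "f \<le> g \<or> g \<le> f" if "f \<in> C" "g \<in> C" for f g
        using C that by (auto simp: Chains_def relation_of_def)
      have bdd: "bdd_below ((\<lambda>f. f x) ` C)" for x
      proof (rule bdd_belowI2[where m = "- p (- x)"])
        fix f assume "f \<in> C"
        then show "- p (- x) \<le> f x"
          using sublinear_ge_neg[OF sub(1), of f x] le_funD[OF sub(2), of f "- x"] by simp
      qed
      have "sublinear (\<lambda>x. INF f\<in>C. f x)"
      proof (rule sublinear_INF[OF False bdd])
        fix f g x y assume fg: "f \<in> C" "g \<in> C"
        then obtain k where k: "k \<in> C" "k \<le> f" "k \<le> g"
          using tot[OF fg] by auto
        have "k (x + y) \<le> k x + k y"
          using k(1) by (intro sublinear_add sub)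
        also have "\<dots> \<le> f x + g y"
          using k by (intro add_mono) (auto dest: le_funD)
        finally show "\<exists>k\<in>C. k (x + y) \<le> f x + g y"
          using k(1) by blast
      next
        fix f x and c :: real assume "f \<in> C" "0 < c"
        then show "\<exists>k\<in>C. k (c *\<^sub>R x) \<le> c * f x"
          using sublinear_scale_le[OF sub(1)] by blast
      qed
      moreover have le: "(\<lambda>x. INF f\<in>C. f x) \<le> f" if "f \<in> C" for f
        using cINF_lower[OF bdd that] by (intro le_funI)
      moreover have "(\<lambda>x. INF f\<in>C. f x) \<le> p"
        using False le sub(2) by (meson ex_in_conv order_trans)
      ultimately show ?thesis by blast
    qed
  qed
  then obtain q where q: "sublinear q" "q \<le> p" "\<And>r. sublinear r \<Longrightarrow> r \<le> p \<Longrightarrow> r \<le> q \<Longrightarrow> r = q"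
    by blast
  have "linear q"
    using q by (intro minimal_sublinear_is_linear) (auto intro: order_trans)
  then show thesis
    using q(2) that by (auto simp: le_fun_def)
qed

lemma scaleC_minus_one: "(-1) *\<^sub>C x = - (x::'x::complex_banach)"
  using scaleR_scaleC[of "-1" x] by simp

lemma scaleC_one: "1 *\<^sub>C x = (x::'x::complex_banach)"
  using scaleR_scaleC[of 1 x] by simp

lemma dual_ballI:
  assumes add: "\<And>x y. f (x + y) = f x + f y" and scale: "\<And>c x. f (c *\<^sub>C x) = c * f x"
    and le: "\<And>x. cmod (f x) \<le> norm x"
  shows "f \<in> dual_ball"
proof -
  have "bounded_linear f"
    using le by (intro bounded_linear_intro[where K = 1])
      (simp_all add: add scaleR_scaleC scale scaleR_conv_of_real)
  moreover have "onorm f \<le> 1"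
    using le by (intro onorm_bound) auto
  ultimately show ?thesis
    using scale by (simp add: dual_ball_def)
qed

lemma dual_ballD:
  assumes "x' \<in> dual_ball"
  shows "bounded_linear x'" "x' (c *\<^sub>C x) = c * x' x" "cmod (x' x) \<le> norm x"
proof -
  show 1: "bounded_linear x'" and "x' (c *\<^sub>C x) = c * x' x"
    using assms by (auto simp: dual_ball_def)
  have "cmod (x' x) \<le> onorm x' * norm x"
    by (rule onorm[OF 1])
  also have "\<dots> \<le> 1 * norm x"
    using assms by (intro mult_right_mono) (auto simp: dual_ball_def)
  finally show "cmod (x' x) \<le> norm x" by simp
qed

text \<open>Norm-preserving extension of a functional \<open>f\<close> from a complex subspace \<open>M\<close>. The sublinear functional
  \<open>q x = inf {\<parallel>x - m\<parallel> + Re (f m) | m \<in> M}\<close> lies below the norm, and \<open>q m \<le> Re (f m)\<close>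
  on \<open>M\<close>. A real-linear \<open>F \<le> q\<close> therefore agrees with \<open>Re f\<close> on \<open>M\<close>, because both \<open>m\<close> and \<open>- m\<close>
  belong to \<open>M\<close>. The complex functional is recovered from its real part as
  \<open>x \<mapsto> F x - \<i> F (\<i> x)\<close>.\<close>

theorem hahn_banach_complex:
  fixes f :: "'x::complex_banach \<Rightarrow> complex"
  assumes zero: "0 \<in> M" and M_add: "\<And>x y. x \<in> M \<Longrightarrow> y \<in> M \<Longrightarrow> x + y \<in> M"
    and M_scale: "\<And>c x. x \<in> M \<Longrightarrow> c *\<^sub>C x \<in> M"
    and f_add: "\<And>x y. x \<in> M \<Longrightarrow> y \<in> M \<Longrightarrow> f (x + y) = f x + f y"
    and f_scale: "\<And>c x. x \<in> M \<Longrightarrow> f (c *\<^sub>C x) = c * f x"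
    and f_le: "\<And>x. x \<in> M \<Longrightarrow> cmod (f x) \<le> norm x"
  obtains y' where "y' \<in> dual_ball" "\<And>x. x \<in> M \<Longrightarrow> y' x = f x"
proof -
  let ?h = "\<lambda>m x. norm (x - m) + Re (f m)"
  let ?q = "\<lambda>x. INF m\<in>M. ?h m x"
  have bdd: "bdd_below ((\<lambda>m. ?h m x) ` M)" for x
  proof (rule bdd_belowI2[where m = "- norm x"])
    fix m assume m: "m \<in> M"
    have "- Re (f m) \<le> norm m"
      using f_le[OF m] abs_Re_le_cmod[of "f m"] by linarith
    also have "norm m \<le> norm x + norm (x - m)"
      using norm_triangle_ineq4[of x "x - m"] by simp
    finally show "- norm x \<le> ?h m x" by simp
  qed
  have "sublinear ?q"
  proof (rule sublinear_INF)
    fix m n x y assume mn: "m \<in> M" "n \<in> M"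
    have "?h (m + n) (x + y) \<le> ?h m x + ?h n y"
      using norm_triangle_ineq[of "x - m" "y - n"] f_add[OF mn] by (simp add: algebra_simps)
    then show "\<exists>k\<in>M. ?h k (x + y) \<le> ?h m x + ?h n y"
      using M_add[OF mn] by blast
  next
    fix m x and c :: real assume mc: "m \<in> M" "0 < c"
    have "norm (c *\<^sub>R x - c *\<^sub>R m) = c * norm (x - m)"
      using mc(2) by (simp flip: scaleR_diff_right)
    moreover have "f (c *\<^sub>R m) = c * f m"
      using f_scale[OF mc(1), of "of_real c"] by (simp add: scaleR_scaleC)
    ultimately have "?h (c *\<^sub>R m) (c *\<^sub>R x) \<le> c * ?h m x"
      by (simp add: algebra_simps)
    moreover have "c *\<^sub>R m \<in> M"
      using M_scale[OF mc(1), of "of_real c"] by (simp add: scaleR_scaleC)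
    ultimately show "\<exists>k\<in>M. ?h k (c *\<^sub>R x) \<le> c * ?h m x"
      by blast
  qed (use zero bdd in auto)
  then obtain F where F: "linear F" "\<And>x. F x \<le> ?q x"
    using linear_below_sublinear by blast
  have le_h: "F x \<le> ?h m x" if "m \<in> M" for m x
    using F(2)[of x] cINF_lower[OF bdd that, of x] by linarith
  have f0: "f 0 = 0"
    using f_add[OF zero zero] by simp
  have F_le: "F x \<le> norm x" for x
    using le_h[OF zero, of x] f0 by simp
  have F_eq: "F m = Re (f m)" if m: "m \<in> M" for m
  proof (rule antisym)
    show "F m \<le> Re (f m)"
      using le_h[OF m, of m] by simp
    have m': "- m \<in> M" "f (- m) = - f m"
      using M_scale[OF m, of "-1"] f_scale[OF m, of "-1"] by (simp_all add: scaleC_minus_one)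
    show "Re (f m) \<le> F m"
      using le_h[OF m'(1), of "- m"] m'(2) linear_neg[OF F(1), of m] by simp
  qed
  define y' where "y' = (\<lambda>x. Complex (F x) (- F (\<i> *\<^sub>C x)))"
  note F_lin = linear_add[OF F(1)] linear_neg[OF F(1)] linear_scale[OF F(1)]
  have i_i: "\<i> *\<^sub>C \<i> *\<^sub>C x = - x" for x :: 'x
    by (simp add: scaleC_scaleC scaleC_minus_one)
  have scale: "y' (c *\<^sub>C x) = c * y' x" for c x
  proof -
    have 1: "c *\<^sub>C x = Re c *\<^sub>R x + Im c *\<^sub>R (\<i> *\<^sub>C x)"
      using arg_cong[OF complex_eq[of c], of "\<lambda>d. d *\<^sub>C x"]
      by (simp add: scaleR_scaleC scaleC_scaleC mult.commute scaleC_add_left)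
    have 2: "\<i> *\<^sub>C c *\<^sub>C x = Re c *\<^sub>R (\<i> *\<^sub>C x) - Im c *\<^sub>R x"
      unfolding 1 scaleC_add_right
      by (simp add: i_i[symmetric] scaleR_scaleC scaleC_scaleC mult.commute)
    show ?thesis
      unfolding y'_def 2 unfolding 1
      by (simp add: complex_eq_iff F_lin linear_diff[OF F(1)])
  qed
  have "y' \<in> dual_ball"
  proof (rule dual_ballI)
    show "y' (x + y) = y' x + y' y" for x y
      by (simp add: y'_def complex_eq_iff F_lin scaleC_add_right)
    show "y' (c *\<^sub>C x) = c * y' x" for c x by (rule scale)
    show "cmod (y' x) \<le> norm x" for x
    proof (cases "y' x = 0")
      case False
      \<comment> \<open>Rotating \<open>x\<close> by the unimodular \<open>c\<close> makes the value real, so that the bound on \<open>F\<close> applies.\<close>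
      define c where "c = cnj (y' x) / cmod (y' x)"
      have c: "cmod c = 1" "c * y' x = cmod (y' x)"
        using False complex_norm_square[of "y' x"]
        by (auto simp: c_def norm_divide field_simps power2_eq_square)
      have "cmod (y' x) = Re (y' (c *\<^sub>C x))"
        unfolding scale c by simp
      also have "\<dots> \<le> norm (c *\<^sub>C x)"
        using F_le by (simp add: y'_def)
      finally show ?thesis
        by (simp add: norm_scaleC c)
    qed auto
  qed
  moreover have "y' x = f x" if x: "x \<in> M" for x
    using F_eq[OF x] F_eq[OF M_scale[OF x, of \<i>]] f_scale[OF x, of \<i>]
    by (simp add: y'_def complex_eq_iff)
  ultimately show thesis using that by blast
qed


section \<open>Translations and the integrals of simple functions\<close>

lemma image_translation_eq_vimage: "(+) s ` A = (\<lambda>t. - s + t) -` (A :: 'g::group_add set)"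
  by (force simp: image_iff add.assoc[symmetric])

lemma borel_measurable_translation [measurable]:
  "(\<lambda>t. s + t) \<in> borel_measurable (borel :: 'g::topological_group_add measure)"
  by (intro borel_measurable_continuous_onI continuous_intros)

lemma sets_borel_translation:
  assumes "A \<in> sets borel"
  shows "(+) s ` A \<in> sets (borel :: 'g::topological_group_add measure)"
  using measurable_sets[OF borel_measurable_translation[of "- s"] assms]
  by (simp add: image_translation_eq_vimage)

lemma translate_translate: "translate s (translate r f) = translate (s + r) f"
  by (simp add: translate_def minus_add add.assoc flip: add_uminus_conv_diff)

lemma translate_zero: "translate 0 f = f"
  by (simp add: translate_def)

lemma simple_function_translate:
  "simple_function borel \<phi> \<Longrightarrow> simple_function (borel :: 'g::topological_group_add measure) (translate s \<phi>)"
  unfolding translate_def by (rule simple_function_comp[OF borel_measurable_translation])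

lemma borel_measurable_translate:
  "f \<in> borel_measurable borel \<Longrightarrow>
    translate s f \<in> borel_measurable (borel :: 'g::topological_group_add measure)"
  unfolding translate_def by (rule measurable_compose[OF borel_measurable_translation])

lemma translate_indicator: "translate s (indicator A) = indicator ((+) s ` A)"
  by (auto simp: translate_def image_translation_eq_vimage indicator_def fun_eq_iff)

lemma vector_measure_Un:
  assumes "vector_measure \<nu>" "A \<in> sets borel" "B \<in> sets borel" "A \<inter> B = {}"
  shows "\<nu> (A \<union> B) = \<nu> A + \<nu> B"
proof -
  have "(\<lambda>n. \<nu> (binaryset A B n)) sums \<nu> (\<Union>n. binaryset A B n)"
    using assms unfolding vector_measure_def
    by (elim allE[where x = "binaryset A B"])
      (auto simp: binaryset_def disjoint_family_on_def split: if_splits)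
  moreover have "(\<lambda>n. \<nu> (binaryset A B n)) sums (\<nu> A + \<nu> B)"
    using assms(1) by (intro binaryset_sums vector_measure_empty)
  ultimately show ?thesis
    by (simp add: UN_binaryset_eq sums_unique2)
qed

lemma vector_measure_UN:
  assumes \<nu>: "vector_measure \<nu>" and I: "finite I" and A: "\<And>i. i \<in> I \<Longrightarrow> A i \<in> sets borel"
    and disj: "disjoint_family_on A I"
  shows "\<nu> (\<Union>i\<in>I. A i) = (\<Sum>i\<in>I. \<nu> (A i))"
  using I A disj
proof (induction I)
  case (insert i I)
  have "\<nu> (A i \<union> (\<Union>j\<in>I. A j)) = \<nu> (A i) + \<nu> (\<Union>j\<in>I. A j)"
  proof (rule vector_measure_Un[OF \<nu>])
    show "A i \<inter> (\<Union>j\<in>I. A j) = {}"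
    proof -
      have "A i \<inter> A j = {}" if "j \<in> I" for j
        using insert.hyps(2) insert.prems(2) that by (auto simp: disjoint_family_on_def)
      then show ?thesis by blast
    qed
  qed (use insert in auto)
  then show ?case
    using insert by (auto simp: disjoint_family_on_def)
qed (simp add: vector_measure_empty[OF \<nu>])

lemma scaleC_zero_left: "0 *\<^sub>C x = (0::'x::complex_banach)"
  using scaleR_scaleC[of 0 x] by simp

lemma scaleC_zero_right: "c *\<^sub>C 0 = (0::'x::complex_banach)"
  using scaleC_add_right[of c 0 "0::'x"] by simp

lemma scaleC_sum_right: "c *\<^sub>C (\<Sum>i\<in>I. f i) = (\<Sum>i\<in>I. c *\<^sub>C (f i :: 'x::complex_banach))"
  by (induction I rule: infinite_finite_induct) (simp_all add: scaleC_zero_right scaleC_add_right)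

text \<open>The integral may be computed from any representation over a finite measurable partition, here the
  level sets of \<open>h\<close>, not only from the canonical one. Taking for \<open>h\<close> a pair of simple functions,
  with \<open>u\<close> the sum and the two projections, gives additivity of the integral.\<close>

lemma vm_simple_integral_comp:
  assumes \<nu>: "vector_measure \<nu>" and h: "simple_function borel h"
  shows "vm_simple_integral \<nu> (\<lambda>t. u (h t)) = (\<Sum>b\<in>range h. u b *\<^sub>C \<nu> (h -` {b}))"
proof -
  have fin: "finite (range h)" and meas: "\<And>B. h -` B \<in> sets borel"
    using simple_functionD[OF h] by auto
  have "vm_simple_integral \<nu> (\<lambda>t. u (h t))
      = (\<Sum>\<alpha>\<in>u ` range h. \<Sum>b | b \<in> range h \<and> u b = \<alpha>. u b *\<^sub>C \<nu> (h -` {b}))"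
    unfolding vm_simple_integral_def
  proof (rule sum.cong)
    fix \<alpha>
    have "(\<lambda>t. u (h t)) -` {\<alpha>} = (\<Union>b\<in>{b. b \<in> range h \<and> u b = \<alpha>}. h -` {b})"
      by auto
    then have "\<nu> ((\<lambda>t. u (h t)) -` {\<alpha>}) = (\<Sum>b | b \<in> range h \<and> u b = \<alpha>. \<nu> (h -` {b}))"
      using vector_measure_UN[OF \<nu>, of "{b. b \<in> range h \<and> u b = \<alpha>}" "\<lambda>b. h -` {b}"] fin meas
      by (auto simp: disjoint_family_on_def)
    then show "\<alpha> *\<^sub>C \<nu> ((\<lambda>t. u (h t)) -` {\<alpha>})
        = (\<Sum>b | b \<in> range h \<and> u b = \<alpha>. u b *\<^sub>C \<nu> (h -` {b}))"
      by (auto simp: scaleC_sum_right intro!: sum.cong)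
  qed auto
  also have "\<dots> = (\<Sum>b\<in>range h. u b *\<^sub>C \<nu> (h -` {b}))"
    using fin by (intro sum.group) auto
  finally show ?thesis .
qed

lemma vm_simple_integral_add:
  assumes \<nu>: "vector_measure \<nu>" and "simple_function borel \<phi>" "simple_function borel \<psi>"
  shows "vm_simple_integral \<nu> (\<lambda>t. \<phi> t + \<psi> t) = vm_simple_integral \<nu> \<phi> + vm_simple_integral \<nu> \<psi>"
proof -
  have h: "simple_function borel (\<lambda>t. (\<phi> t, \<psi> t))"
    using assms(2,3) by (rule simple_function_Pair)
  show ?thesis
    using vm_simple_integral_comp[OF \<nu> h, of "\<lambda>(a, b). a + b"]
      vm_simple_integral_comp[OF \<nu> h, of fst] vm_simple_integral_comp[OF \<nu> h, of snd]
    by (simp add: case_prod_beta scaleC_add_left sum.distrib)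
qed

lemma vm_simple_integral_scale:
  assumes \<nu>: "vector_measure \<nu>" and \<phi>: "simple_function borel \<phi>"
  shows "vm_simple_integral \<nu> (\<lambda>t. c * \<phi> t) = c *\<^sub>C vm_simple_integral \<nu> \<phi>"
  using vm_simple_integral_comp[OF \<nu> \<phi>, of "\<lambda>a. c * a"]
  by (simp add: vm_simple_integral_def scaleC_sum_right scaleC_scaleC)

lemma vm_simple_integral_diff:
  assumes \<nu>: "vector_measure \<nu>" and "simple_function borel \<phi>" "simple_function borel \<psi>"
  shows "vm_simple_integral \<nu> (\<lambda>t. \<phi> t - \<psi> t) = vm_simple_integral \<nu> \<phi> - vm_simple_integral \<nu> \<psi>"
  using vm_simple_integral_add[OF \<nu> assms(2), of "\<lambda>t. -1 * \<psi> t"]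
    vm_simple_integral_scale[OF \<nu> assms(3), of "-1"] simple_function_compose1[OF assms(3), of "\<lambda>a. -1 * a"]
  by (simp add: scaleC_minus_one)

lemma vm_simple_integral_indicator:
  assumes \<nu>: "vector_measure \<nu>"
  shows "vm_simple_integral \<nu> (indicator A) = \<nu> A"
proof -
  have "vm_simple_integral \<nu> (indicator A)
      = (\<Sum>\<alpha>\<in>{0, 1::complex}. \<alpha> *\<^sub>C \<nu> (indicator A -` {\<alpha>}))"
    unfolding vm_simple_integral_def
  proof (rule sum.mono_neutral_left)
    show "\<forall>\<alpha>\<in>{0, 1} - range (indicator A). \<alpha> *\<^sub>C \<nu> (indicator A -` {\<alpha>}) = 0"
    proof
      fix \<alpha> :: complex assume "\<alpha> \<in> {0, 1} - range (indicator A)"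
      then have "indicator A -` {\<alpha>} = {}" by auto
      then show "\<alpha> *\<^sub>C \<nu> (indicator A -` {\<alpha>}) = 0"
        by (simp add: vector_measure_empty[OF \<nu>] scaleC_zero_right)
    qed
  qed (auto simp: indicator_def)
  moreover have "indicator A -` {1::complex} = A"
    by (auto simp: indicator_def)
  ultimately show ?thesis
    by (simp add: scaleC_zero_left scaleC_one)
qed

lemma norm_vm_translation:
  assumes \<nu>: "vector_measure \<nu>" "norm_integral_translation_invariant \<nu>"
    and A: "A \<in> sets borel"
  shows "norm (\<nu> ((+) s ` A)) = norm (\<nu> A)"
proof -
  have "simple_function borel (indicator A :: _ \<Rightarrow> complex)"
    using A by (rule simple_function_indicator)
  then have "norm (vm_simple_integral \<nu> (translate s (indicator A))) = norm (vm_simple_integral \<nu> (indicator A))"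
    using \<nu>(2) unfolding norm_integral_translation_invariant_def by blast
  then show ?thesis
    by (simp add: translate_indicator vm_simple_integral_indicator[OF \<nu>(1)])
qed

text \<open>Translation invariance says that \<open>I\<^sub>\<nu> \<phi> \<mapsto> I\<^sub>\<nu> (\<tau>\<^sub>s \<phi>)\<close> is a well-defined linear isometry \<open>T\<close> on the
  range of \<open>I\<^sub>\<nu>\<close>. Composing \<open>x'\<close> with it gives a functional of norm at most one on that subspace,
  and \<open>y'\<close> is a Hahn--Banach extension of it. So translating the scalar measure of \<open>x'\<close> yields the
  scalar measure of another functional in the dual ball.\<close>

lemma translated_functional:
  fixes \<nu> :: "'g::topological_group_add set \<Rightarrow> 'x::complex_banach"
  assumes \<nu>: "vector_measure \<nu>" "norm_integral_translation_invariant \<nu>"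
    and x': "x' \<in> dual_ball"
  obtains y' where "y' \<in> dual_ball" "\<And>A. A \<in> sets borel \<Longrightarrow> x' (\<nu> ((+) s ` A)) = y' (\<nu> A)"
proof -
  let ?S = "{\<phi>. simple_function (borel :: 'g measure) \<phi>} :: ('g \<Rightarrow> complex) set"
  let ?I = "vm_simple_integral \<nu>"
  let ?J = "\<lambda>\<phi>. ?I (translate s \<phi>)"
  define T where "T y = ?J (inv_into ?S ?I y)" for y
  have S_add: "(\<lambda>t. \<phi> t + \<psi> t) \<in> ?S" if "\<phi> \<in> ?S" "\<psi> \<in> ?S" for \<phi> \<psi>
    using that simple_function_compose2[of borel \<phi> \<psi> "(+)"] by auto
  have S_diff: "(\<lambda>t. \<phi> t - \<psi> t) \<in> ?S" if "\<phi> \<in> ?S" "\<psi> \<in> ?S" for \<phi> \<psi>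
    using that simple_function_compose2[of borel \<phi> \<psi> "(-)"] by auto
  have S_scale: "(\<lambda>t. c * \<phi> t) \<in> ?S" if "\<phi> \<in> ?S" for \<phi> c
    using that simple_function_compose1[of borel \<phi> "(*) c"] by auto
  have S_tr: "simple_function borel (translate s \<phi>)" if "\<phi> \<in> ?S" for \<phi>
    using that simple_function_translate by auto
  have J_add: "?J (\<lambda>t. \<phi> t + \<psi> t) = ?J \<phi> + ?J \<psi>" if "\<phi> \<in> ?S" "\<psi> \<in> ?S" for \<phi> \<psi>
    using vm_simple_integral_add[OF \<nu>(1) S_tr S_tr, OF that] by (simp add: translate_def)
  have J_diff: "?J (\<lambda>t. \<phi> t - \<psi> t) = ?J \<phi> - ?J \<psi>" if "\<phi> \<in> ?S" "\<psi> \<in> ?S" for \<phi> \<psi>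
    using vm_simple_integral_diff[OF \<nu>(1) S_tr S_tr, OF that] by (simp add: translate_def)
  have J_scale: "?J (\<lambda>t. c * \<phi> t) = c *\<^sub>C ?J \<phi>" if "\<phi> \<in> ?S" for \<phi> c
    using vm_simple_integral_scale[OF \<nu>(1) S_tr, OF that] by (simp add: translate_def)
  have J_norm: "norm (?J \<phi>) = norm (?I \<phi>)" if "\<phi> \<in> ?S" for \<phi>
    using \<nu>(2) that unfolding norm_integral_translation_invariant_def by blast
  have T: "T (?I \<phi>) = ?J \<phi>" if \<phi>: "\<phi> \<in> ?S" for \<phi>
  proof -
    define \<psi> where "\<psi> = inv_into ?S ?I (?I \<phi>)"
    have \<psi>: "\<psi> \<in> ?S" "?I \<psi> = ?I \<phi>"
      unfolding \<psi>_def
      using inv_into_into[OF imageI[OF \<phi>]] f_inv_into_f[OF imageI[OF \<phi>]] by auto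
    have "norm (?J (\<lambda>t. \<psi> t - \<phi> t)) = norm (?I \<psi> - ?I \<phi>)"
      using J_norm[OF S_diff[OF \<psi>(1) \<phi>]] vm_simple_integral_diff[OF \<nu>(1), of \<psi> \<phi>] \<psi>(1) \<phi>
      by simp
    then show ?thesis
      using J_diff[OF \<psi>(1) \<phi>] \<psi>(2) by (simp add: T_def \<psi>_def)
  qed
  note x'_lin = dual_ballD(1)[OF x'] and x'_scale = dual_ballD(2)[OF x'] and x'_le = dual_ballD(3)[OF x']
  have I_add: "?I (\<lambda>t. \<phi> t + \<psi> t) = ?I \<phi> + ?I \<psi>" if "\<phi> \<in> ?S" "\<psi> \<in> ?S" for \<phi> \<psi>
    using vm_simple_integral_add[OF \<nu>(1)] that by simp
  have I_scale: "?I (\<lambda>t. c * \<phi> t) = c *\<^sub>C ?I \<phi>" if "\<phi> \<in> ?S" for \<phi> c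
    using vm_simple_integral_scale[OF \<nu>(1)] that by simp
  obtain y' where y': "y' \<in> dual_ball" "\<And>x. x \<in> ?I ` ?S \<Longrightarrow> y' x = x' (T x)"
  proof (rule hahn_banach_complex[where M = "?I ` ?S" and f = "\<lambda>x. x' (T x)"])
    have "?I (\<lambda>_. 0) = 0"
      by (simp add: vm_simple_integral_def scaleC_zero_left)
    then show "0 \<in> ?I ` ?S"
      by (force simp: image_iff intro!: exI[of _ "\<lambda>_. 0"])
  next
    fix x y assume "x \<in> ?I ` ?S" "y \<in> ?I ` ?S"
    then obtain \<phi> \<psi> where *: "x = ?I \<phi>" "\<phi> \<in> ?S" "y = ?I \<psi>" "\<psi> \<in> ?S" by blast
    have xy: "x + y = ?I (\<lambda>t. \<phi> t + \<psi> t)"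
      using I_add[OF *(2,4)] *(1,3) by simp
    then show "x + y \<in> ?I ` ?S"
      using S_add[OF *(2,4)] by blast
    have "T (x + y) = T x + T y"
      unfolding xy T[OF S_add[OF *(2,4)]] unfolding *(1,3) T[OF *(2)] T[OF *(4)] by (rule J_add[OF *(2,4)])
    then show "x' (T (x + y)) = x' (T x) + x' (T y)"
      using x'_lin by (simp add: linear_add bounded_linear.linear)
  next
    fix c x assume "x \<in> ?I ` ?S"
    then obtain \<phi> where *: "x = ?I \<phi>" "\<phi> \<in> ?S" by blast
    have cx: "c *\<^sub>C x = ?I (\<lambda>t. c * \<phi> t)"
      using I_scale[OF *(2)] *(1) by simp
    then show "c *\<^sub>C x \<in> ?I ` ?S"
      using S_scale[OF *(2)] by blast
    show "x' (T (c *\<^sub>C x)) = c * x' (T x)"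
      unfolding cx T[OF S_scale[OF *(2)]] J_scale[OF *(2)] x'_scale unfolding *(1) T[OF *(2)] by simp
  next
    fix x assume "x \<in> ?I ` ?S"
    then obtain \<phi> where *: "x = ?I \<phi>" "\<phi> \<in> ?S" by blast
    show "cmod (x' (T x)) \<le> norm x"
      using x'_le[of "?J \<phi>"] T[OF *(2)] J_norm[OF *(2)] *(1) by simp
  qed blast
  have "x' (\<nu> ((+) s ` A)) = y' (\<nu> A)" if A: "A \<in> sets borel" for A
  proof -
    have \<phi>: "indicator A \<in> ?S"
      using A by (simp add: simple_function_indicator)
    then have "y' (?I (indicator A)) = x' (?J (indicator A))"
      using y'(2) T[OF \<phi>] by auto
    then show ?thesis
      by (simp add: translate_indicator vm_simple_integral_indicator[OF \<nu>(1)])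
  qed
  with y'(1) show thesis using that by blast
qed


section \<open>Translation invariance of the Orlicz norm\<close>

lemma vector_measure_functional:
  assumes "vector_measure \<nu>" "x' \<in> dual_ball"
  shows "vector_measure (\<lambda>A. x' (\<nu> A))"
  using assms(1) bounded_linear.sums[OF dual_ballD(1)[OF assms(2)]]
  by (simp add: vector_measure_def)

lemma measurable_variation_measure:
  "measurable (variation_measure \<mu>) N = measurable borel N"
  by (rule measurable_cong_sets[OF sets_variation_measure refl])

text \<open>Translation maps the partitions of \<open>A\<close> to partitions of the translate of \<open>A\<close>, with the same
  variation sums. Applied to \<open>s\<close> and to \<open>- s\<close>, this gives equality.\<close>

lemma total_variation_le_translation:
  fixes \<mu> \<rho> :: "'g::topological_group_add set \<Rightarrow> complex"
  assumes eq: "\<And>B. B \<in> sets borel \<Longrightarrow> \<mu> B = \<rho> ((+) s ` B)"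
  shows "total_variation \<mu> A \<le> total_variation \<rho> ((+) s ` A)"
  unfolding total_variation_def[of \<mu>]
proof (rule SUP_least)
  fix P assume "P \<in> {P. finite P \<and> P \<subseteq> sets borel \<and> partition_on A P}"
  then have P: "finite P" "P \<subseteq> sets borel" "partition_on A P" by auto
  have inj: "inj_on ((`) ((+) s)) P"
    by (rule inj_on_subset[OF inj_on_image]) auto
  have "(\<Sum>B\<in>P. ennreal (cmod (\<mu> B))) = (\<Sum>B\<in>P. ennreal (cmod (\<rho> ((+) s ` B))))"
    using P(2) by (intro sum.cong) (auto simp: eq)
  also have "\<dots> = (\<Sum>C\<in>(`) ((+) s) ` P. ennreal (cmod (\<rho> C)))"
    by (simp add: sum.reindex[OF inj])
  also have "\<dots> \<le> total_variation \<rho> ((+) s ` A)"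
    unfolding total_variation_def
  proof (rule SUP_upper)
    have "partition_on ((+) s ` A) ((`) ((+) s) ` P)"
    proof -
      have "(`) ((+) s) ` P - {{}} = (`) ((+) s) ` P"
        using P(3) by (auto simp: partition_on_def)
      then show ?thesis
        using partition_on_inj_image[OF P(3), of "(+) s"] by simp
    qed
    then show "(`) ((+) s) ` P
        \<in> {P. finite P \<and> P \<subseteq> sets borel \<and> partition_on ((+) s ` A) P}"
      using P(1,2) sets_borel_translation by auto
  qed
  finally show "(\<Sum>B\<in>P. ennreal (cmod (\<mu> B))) \<le> total_variation \<rho> ((+) s ` A)" .
qed

lemma image_translation_minus: "(+) s ` (+) (- s) ` (A :: 'g::group_add set) = A"
  "(+) (- s) ` (+) s ` (A :: 'g::group_add set) = A"
  by (auto simp: image_image add.assoc[symmetric])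

lemma variation_measure_translation:
  fixes \<mu> \<rho> :: "'g::topological_group_add set \<Rightarrow> complex"
  assumes \<mu>: "vector_measure \<mu>" and \<rho>: "vector_measure \<rho>"
    and eq: "\<And>B. B \<in> sets borel \<Longrightarrow> \<mu> B = \<rho> ((+) s ` B)"
  shows "variation_measure \<mu> = distr (variation_measure \<rho>) borel (\<lambda>t. - s + t)"
proof (rule measure_eqI)
  fix A assume "A \<in> sets (variation_measure \<mu>)"
  then have A: "A \<in> sets borel" by (simp add: sets_variation_measure)
  have "total_variation \<rho> ((+) s ` A) \<le> total_variation \<mu> ((+) (- s) ` (+) s ` A)"
    by (rule total_variation_le_translation)
      (simp add: eq sets_borel_translation image_translation_minus)
  then have tv: "total_variation \<mu> A = total_variation \<rho> ((+) s ` A)"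
    using total_variation_le_translation[of \<mu> \<rho> s A, OF eq]
    by (simp add: antisym image_translation_minus)
  have "(\<lambda>t. - s + t) \<in> measurable (variation_measure \<rho>) borel"
    using borel_measurable_translation by (simp add: measurable_variation_measure)
  then have "emeasure (distr (variation_measure \<rho>) borel (\<lambda>t. - s + t)) A
      = emeasure (variation_measure \<rho>) ((+) s ` A)"
    using A sets_eq_imp_space_eq[OF sets_variation_measure[of \<rho>]]
    by (simp add: emeasure_distr image_translation_eq_vimage)
  then show "emeasure (variation_measure \<mu>) A
      = emeasure (distr (variation_measure \<rho>) borel (\<lambda>t. - s + t)) A"
    using A by (simp add: tv emeasure_variation_measure \<mu> \<rho> sets_borel_translation)
qed (simp add: sets_variation_measure)

text \<open>A Young function is constrained only on the nonnegative half-line and may be non-measurable on the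
  negative one, whence the truncation in the proof.\<close>

lemma borel_measurable_young:
  assumes \<Phi>: "young_function \<Phi>" and k: "0 < k" and f: "f \<in> borel_measurable M"
  shows "(\<lambda>t. ennreal (\<Phi> (cmod (f t) / k))) \<in> borel_measurable M"
proof -
  have "continuous_on UNIV (\<lambda>x. \<Phi> (max 0 x))"
  proof (rule continuous_on_compose2[of "{0..}" \<Phi> UNIV "\<lambda>x. max 0 x"])
    show "continuous_on {0..} \<Phi>"
      using \<Phi> by (simp add: young_function_def)
    show "continuous_on UNIV (\<lambda>x::real. max 0 x)"
      by (intro continuous_intros)
  qed auto
  then have \<Phi>_max: "(\<lambda>x. \<Phi> (max 0 x)) \<in> borel_measurable borel"
    by (rule borel_measurable_continuous_onI)
  have "(\<lambda>t. cmod (f t) / k) \<in> borel_measurable M"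
    using f by simp
  from measurable_compose[OF this \<Phi>_max] show ?thesis
    using k by (simp add: max_def)
qed

lemma luxemburg_norm_translate:
  fixes \<mu> \<rho> :: "'g::topological_group_add set \<Rightarrow> complex"
  assumes \<Phi>: "young_function \<Phi>" and f: "f \<in> borel_measurable borel"
    and \<mu>: "vector_measure \<mu>" and \<rho>: "vector_measure \<rho>"
    and eq: "\<And>B. B \<in> sets borel \<Longrightarrow> \<mu> B = \<rho> ((+) s ` B)"
  shows "luxemburg_norm \<Phi> (variation_measure \<rho>) (translate s f)
      = luxemburg_norm \<Phi> (variation_measure \<mu>) f"
proof -
  have distr: "variation_measure \<mu> = distr (variation_measure \<rho>) borel (\<lambda>t. - s + t)"
    by (rule variation_measure_translation[OF \<mu> \<rho> eq])
  have "(\<integral>\<^sup>+t. ennreal (\<Phi> (cmod (f t) / k)) \<partial>variation_measure \<mu>)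
      = (\<integral>\<^sup>+t. ennreal (\<Phi> (cmod (translate s f t) / k)) \<partial>variation_measure \<rho>)" if k: "0 < k" for k
    unfolding distr translate_def
    using borel_measurable_translation borel_measurable_young[OF \<Phi> k f]
    by (intro nn_integral_distr) (simp_all add: measurable_variation_measure)
  then show ?thesis
    unfolding luxemburg_norm_def by (intro arg_cong[where f = Inf] image_cong) auto
qed

text \<open>The translate of \<open>f\<close>, measured with \<open>x'\<close>, has the Luxemburg norm of \<open>f\<close> measured with some
  \<open>y'\<close> in the dual ball; this gives one inequality. The other is the same inequality for the inverse
  translation.\<close>

theorem orlicz_norm_translate:
  fixes \<nu> :: "'g::topological_group_add set \<Rightarrow> 'x::complex_banach"
  assumes \<Phi>: "young_function \<Phi>"
    and \<nu>: "vector_measure \<nu>" "norm_integral_translation_invariant \<nu>"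
    and f: "f \<in> borel_measurable borel"
  shows "orlicz_norm \<Phi> \<nu> (translate s f) = orlicz_norm \<Phi> \<nu> f"
proof -
  have le: "orlicz_norm \<Phi> \<nu> (translate s f) \<le> orlicz_norm \<Phi> \<nu> f"
    if f: "f \<in> borel_measurable borel" for f s
    unfolding orlicz_norm_def[of _ _ "translate s f"]
  proof (rule SUP_least)
    fix x' :: "'x \<Rightarrow> complex" assume x': "x' \<in> dual_ball"
    obtain y' where y': "y' \<in> dual_ball" "\<And>A. A \<in> sets borel \<Longrightarrow> x' (\<nu> ((+) s ` A)) = y' (\<nu> A)"
      using translated_functional[OF \<nu> x', of s] by blast
    have "luxemburg_norm \<Phi> (variation_measure (\<lambda>A. x' (\<nu> A))) (translate s f)
        = luxemburg_norm \<Phi> (variation_measure (\<lambda>A. y' (\<nu> A))) f"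
      using x' y' by (intro luxemburg_norm_translate[OF \<Phi> f] vector_measure_functional \<nu>) auto
    also have "\<dots> \<le> orlicz_norm \<Phi> \<nu> f"
      unfolding orlicz_norm_def by (rule SUP_upper[OF y'(1)])
    finally show "luxemburg_norm \<Phi> (variation_measure (\<lambda>A. x' (\<nu> A))) (translate s f)
        \<le> orlicz_norm \<Phi> \<nu> f" .
  qed
  have "orlicz_norm \<Phi> \<nu> f = orlicz_norm \<Phi> \<nu> (translate (- s) (translate s f))"
    by (simp add: translate_translate translate_zero)
  also have "\<dots> \<le> orlicz_norm \<Phi> \<nu> (translate s f)"
    by (rule le[OF borel_measurable_translate[OF f]])
  finally show ?thesis
    using le[OF f] by (simp add: antisym)
qed


section \<open>The triangle inequality\<close>

lemma young_mono: "young_function \<Phi> \<Longrightarrow> 0 \<le> x \<Longrightarrow> x \<le> y \<Longrightarrow> \<Phi> x \<le> \<Phi> y"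
  by (auto simp: young_function_def intro: strict_mono_on_leD)

text \<open>If \<open>a\<close> and \<open>b\<close> are admissible for \<open>f\<close> and \<open>g\<close>, then \<open>a + b\<close> is admissible for the sum: the quotient
  \<open>(\<bar>f\<bar> + \<bar>g\<bar>) / (a + b)\<close> is the convex combination of \<open>\<bar>f\<bar> / a\<close> and \<open>\<bar>g\<bar> / b\<close> with weights
  \<open>a / (a + b)\<close> and \<open>b / (a + b)\<close>, and \<open>\<Phi>\<close> is convex.\<close>

lemma luxemburg_norm_triangle:
  assumes \<Phi>: "young_function \<Phi>" and f: "f \<in> borel_measurable M" and g: "g \<in> borel_measurable M"
  shows "luxemburg_norm \<Phi> M (\<lambda>t. f t + g t) \<le> luxemburg_norm \<Phi> M f + luxemburg_norm \<Phi> M g"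
proof -
  let ?A = "\<lambda>f. {k::real. 0 < k \<and> (\<integral>\<^sup>+t. ennreal (\<Phi> (cmod (f t) / k)) \<partial>M) \<le> 1}"
  have \<Phi>0: "0 \<le> \<Phi> x" if "0 \<le> x" for x
    using \<Phi> that by (auto simp: young_function_def)
  have conv: "convex_on {0..} \<Phi>"
    using \<Phi> by (simp add: young_function_def)
  have sum: "a + b \<in> ?A (\<lambda>t. f t + g t)" if a: "a \<in> ?A f" and b: "b \<in> ?A g" for a b
  proof -
    have ab: "0 < a" "0 < b" using a b by auto
    define u where "u = b / (a + b)"
    have u: "0 \<le> u" "u \<le> 1" "1 - u = a / (a + b)"
      using ab by (auto simp: u_def field_simps)
    have "\<Phi> (cmod (f t + g t) / (a + b))
        \<le> (1 - u) * \<Phi> (cmod (f t) / a) + u * \<Phi> (cmod (g t) / b)" for t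
    proof -
      have "\<Phi> (cmod (f t + g t) / (a + b)) \<le> \<Phi> ((cmod (f t) + cmod (g t)) / (a + b))"
        using ab by (intro young_mono[OF \<Phi>] divide_right_mono norm_triangle_ineq) auto
      also have "(cmod (f t) + cmod (g t)) / (a + b)
          = (1 - u) *\<^sub>R (cmod (f t) / a) + u *\<^sub>R (cmod (g t) / b)"
        unfolding u(3) unfolding u_def using ab by (simp add: add_divide_distrib)
      also have "\<Phi> \<dots> \<le> (1 - u) * \<Phi> (cmod (f t) / a) + u * \<Phi> (cmod (g t) / b)"
        using u ab by (intro convex_onD[OF conv]) auto
      finally show ?thesis .
    qed
    then have "ennreal (\<Phi> (cmod (f t + g t) / (a + b)))
        \<le> ennreal (1 - u) * ennreal (\<Phi> (cmod (f t) / a)) + ennreal u * ennreal (\<Phi> (cmod (g t) / b))" for t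
      using u ab \<Phi>0 by (simp flip: ennreal_mult ennreal_plus add: ennreal_leI)
    then have "(\<integral>\<^sup>+t. ennreal (\<Phi> (cmod (f t + g t) / (a + b))) \<partial>M)
        \<le> (\<integral>\<^sup>+t. ennreal (1 - u) * ennreal (\<Phi> (cmod (f t) / a))
              + ennreal u * ennreal (\<Phi> (cmod (g t) / b)) \<partial>M)"
      by (intro nn_integral_mono)
    also have "\<dots> = ennreal (1 - u) * (\<integral>\<^sup>+t. ennreal (\<Phi> (cmod (f t) / a)) \<partial>M)
        + ennreal u * (\<integral>\<^sup>+t. ennreal (\<Phi> (cmod (g t) / b)) \<partial>M)"
      using borel_measurable_young[OF \<Phi> ab(1) f] borel_measurable_young[OF \<Phi> ab(2) g]
      by (simp add: nn_integral_add nn_integral_cmult)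
    also have "\<dots> \<le> ennreal (1 - u) * 1 + ennreal u * 1"
      using a b by (intro add_mono mult_left_mono) auto
    also have "\<dots> = 1"
      using u by (simp flip: ennreal_plus)
    finally show ?thesis using ab by simp
  qed
  show ?thesis
  proof (rule ennreal_le_epsilon)
    fix e :: real assume fin: "luxemburg_norm \<Phi> M f + luxemburg_norm \<Phi> M g < top" and e: "0 < e"
    have ex: "\<exists>k\<in>?A h. ennreal k < luxemburg_norm \<Phi> M h + ennreal (e / 2)"
      if "luxemburg_norm \<Phi> M h < top" for h
    proof -
      have "luxemburg_norm \<Phi> M h < luxemburg_norm \<Phi> M h + ennreal (e / 2)"
        using that e by (cases "luxemburg_norm \<Phi> M h") (auto simp flip: ennreal_plus simp: ennreal_less_iff)
      then show ?thesis
        unfolding luxemburg_norm_def[of _ _ h] INF_less_iff .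
    qed
    obtain a b where ab: "a \<in> ?A f" "ennreal a < luxemburg_norm \<Phi> M f + ennreal (e / 2)"
        "b \<in> ?A g" "ennreal b < luxemburg_norm \<Phi> M g + ennreal (e / 2)"
      using ex[of f] ex[of g] fin by (auto simp: less_top)
    have "luxemburg_norm \<Phi> M (\<lambda>t. f t + g t) \<le> ennreal (a + b)"
      unfolding luxemburg_norm_def by (rule INF_lower[OF sum[OF ab(1,3)]])
    also have "\<dots> = ennreal a + ennreal b"
      using ab(1,3) by simp
    also have "\<dots> \<le> (luxemburg_norm \<Phi> M f + ennreal (e / 2)) + (luxemburg_norm \<Phi> M g + ennreal (e / 2))"
      using ab(2,4) by (intro add_mono) auto
    also have "\<dots> = luxemburg_norm \<Phi> M f + luxemburg_norm \<Phi> M g + (ennreal (e / 2) + ennreal (e / 2))"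
      by (simp add: ac_simps)
    also have "ennreal (e / 2) + ennreal (e / 2) = ennreal e"
      using e by (simp flip: ennreal_plus)
    finally show "luxemburg_norm \<Phi> M (\<lambda>t. f t + g t)
        \<le> luxemburg_norm \<Phi> M f + luxemburg_norm \<Phi> M g + ennreal e" .
  qed
qed

lemma orlicz_norm_triangle:
  assumes \<Phi>: "young_function \<Phi>" and f: "f \<in> borel_measurable borel" and g: "g \<in> borel_measurable borel"
  shows "orlicz_norm \<Phi> \<nu> (\<lambda>t. f t + g t) \<le> orlicz_norm \<Phi> \<nu> f + orlicz_norm \<Phi> \<nu> g"
  unfolding orlicz_norm_def[of _ _ "\<lambda>t. f t + g t"]
proof (rule SUP_least)
  fix x' :: "'b \<Rightarrow> complex" assume x': "x' \<in> dual_ball"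
  let ?M = "variation_measure (\<lambda>A. x' (\<nu> A))"
  have "luxemburg_norm \<Phi> ?M (\<lambda>t. f t + g t) \<le> luxemburg_norm \<Phi> ?M f + luxemburg_norm \<Phi> ?M g"
    using f g by (intro luxemburg_norm_triangle[OF \<Phi>])
      (simp_all add: measurable_variation_measure)
  also have "\<dots> \<le> orlicz_norm \<Phi> \<nu> f + orlicz_norm \<Phi> \<nu> g"
    unfolding orlicz_norm_def by (intro add_mono SUP_upper[OF x'])
  finally show "luxemburg_norm \<Phi> ?M (\<lambda>t. f t + g t) \<le> orlicz_norm \<Phi> \<nu> f + orlicz_norm \<Phi> \<nu> g" .
qed

lemma orlicz_norm_minus_commute: "orlicz_norm \<Phi> \<nu> (\<lambda>t. f t - g t) = orlicz_norm \<Phi> \<nu> (\<lambda>t. g t - f t)"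
  by (simp add: orlicz_norm_def luxemburg_norm_def norm_minus_commute)


section \<open>Small sets\<close>

text \<open>The cells on which \<open>\<mu>\<close> is nonnegative, and those on which it is negative, have unions whose
  measures are the corresponding partial sums; each contributes at most \<open>r\<close>.\<close>

lemma sum_abs_vector_measure_le:
  fixes \<mu> :: "'g::topological_space set \<Rightarrow> real"
  assumes \<mu>: "vector_measure \<mu>" and P: "finite P" "P \<subseteq> sets borel" "partition_on A P"
    and bound: "\<And>C. C \<in> sets borel \<Longrightarrow> C \<subseteq> A \<Longrightarrow> \<bar>\<mu> C\<bar> \<le> r"
  shows "(\<Sum>B\<in>P. \<bar>\<mu> B\<bar>) \<le> 2 * r"
proof -
  have le: "\<bar>\<Sum>B\<in>Q. \<mu> B\<bar> \<le> r" if Q: "Q \<subseteq> P" for Q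
  proof -
    have fin: "finite Q" using Q P(1) by (rule finite_subset)
    have "disjoint_family_on (\<lambda>B. B) Q"
    proof -
      have "B \<inter> C = {}" if "B \<in> Q" "C \<in> Q" "B \<noteq> C" for B C
        using P(3) Q that unfolding partition_on_def disjoint_def by blast
      then show ?thesis
        by (simp add: disjoint_family_on_def)
    qed
    then have "\<mu> (\<Union>B\<in>Q. B) = (\<Sum>B\<in>Q. \<mu> B)"
      using Q P(2) by (intro vector_measure_UN[OF \<mu> fin]) auto
    moreover have "\<bar>\<mu> (\<Union>B\<in>Q. B)\<bar> \<le> r"
      using Q P fin by (intro bound sets.finite_UN) (auto simp: partition_on_def)
    ultimately show ?thesis by simp
  qed
  let ?Q = "{B \<in> P. 0 \<le> \<mu> B}"
  have "(\<Sum>B\<in>P. \<bar>\<mu> B\<bar>) = (\<Sum>B\<in>?Q. \<bar>\<mu> B\<bar>) + (\<Sum>B\<in>P - ?Q. \<bar>\<mu> B\<bar>)"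
    using P(1) by (subst add.commute, intro sum.subset_diff) auto
  also have "(\<Sum>B\<in>?Q. \<bar>\<mu> B\<bar>) = (\<Sum>B\<in>?Q. \<mu> B)"
    by (intro sum.cong) auto
  also have "(\<Sum>B\<in>P - ?Q. \<bar>\<mu> B\<bar>) = - (\<Sum>B\<in>P - ?Q. \<mu> B)"
    unfolding sum_negf[symmetric] by (intro sum.cong) auto
  also have "(\<Sum>B\<in>?Q. \<mu> B) + - (\<Sum>B\<in>P - ?Q. \<mu> B) \<le> 2 * r"
    using le[of ?Q] le[of "P - ?Q"] by auto
  finally show ?thesis .
qed

text \<open>Unlike the total variation itself, the bound on the values of \<open>\<mu>\<close> is uniform in \<open>x'\<close> when \<open>\<mu>\<close> is the
  scalar measure that \<open>x'\<close> makes of a vector measure. The factor 4 comes from the positive and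
  negative parts of the real and imaginary parts.\<close>

lemma total_variation_le:
  assumes \<mu>: "vector_measure \<mu>"
    and bound: "\<And>C. C \<in> sets borel \<Longrightarrow> C \<subseteq> A \<Longrightarrow> cmod (\<mu> C) \<le> r"
  shows "total_variation \<mu> A \<le> ennreal (4 * r)"
  unfolding total_variation_def
proof (rule SUP_least)
  fix P assume "P \<in> {P. finite P \<and> P \<subseteq> sets borel \<and> partition_on A P}"
  then have P: "finite P" "P \<subseteq> sets borel" "partition_on A P" by auto
  have re_im: "vector_measure (\<lambda>A. Re (\<mu> A))" "vector_measure (\<lambda>A. Im (\<mu> A))"
    using \<mu> by (simp_all add: vector_measure_def sums_complex_iff)
  have "(\<Sum>B\<in>P. cmod (\<mu> B)) \<le> (\<Sum>B\<in>P. \<bar>Re (\<mu> B)\<bar>) + (\<Sum>B\<in>P. \<bar>Im (\<mu> B)\<bar>)"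
    unfolding sum.distrib[symmetric] by (intro sum_mono cmod_le)
  also have "\<dots> \<le> 2 * r + 2 * r"
    by (intro add_mono sum_abs_vector_measure_le[OF re_im(1) P] sum_abs_vector_measure_le[OF re_im(2) P]
        order_trans[OF abs_Re_le_cmod] order_trans[OF abs_Im_le_cmod] bound)
  finally have "(\<Sum>B\<in>P. cmod (\<mu> B)) \<le> 4 * r" by simp
  then show "(\<Sum>B\<in>P. ennreal (cmod (\<mu> B))) \<le> ennreal (4 * r)"
    by (simp add: ennreal_leI)
qed

text \<open>With \<open>K = \<Phi> (M / \<epsilon>)\<close>, the modular of \<open>g / \<epsilon>\<close> is at most \<open>K\<close> times the variation of \<open>D\<close>. Absolute
  continuity makes \<open>\<parallel>\<nu> C\<parallel>\<close> smaller than \<open>1 / (4 K)\<close> for all Borel subsets \<open>C\<close> of a small set \<open>D\<close>, so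
  that this variation is at most \<open>1 / K\<close> for all functionals in the dual ball at once.\<close>

lemma orlicz_norm_small_support:
  fixes \<nu> :: "'g::topological_space set \<Rightarrow> 'x::complex_banach"
  assumes \<Phi>: "young_function \<Phi>" and \<nu>: "vector_measure \<nu>" and ac: "absolutely_continuous_vm \<nu> m"
    and m: "finite_measure m" "sets m = sets borel"
    and M: "0 < M" and \<epsilon>: "0 < \<epsilon>"
  obtains \<delta> where "0 < \<delta>"
    "\<And>g D. D \<in> sets borel \<Longrightarrow> measure m D < \<delta> \<Longrightarrow> (\<And>t. cmod (g t) \<le> M * indicator D t) \<Longrightarrow>
      orlicz_norm \<Phi> \<nu> g \<le> ennreal \<epsilon>"
proof -
  define K where "K = \<Phi> (M / \<epsilon>)"
  have K: "0 < K"
  proof -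
    have "0 \<le> K" "K \<noteq> 0"
      using \<Phi> M \<epsilon> by (simp_all add: K_def young_function_def)
    then show ?thesis by simp
  qed
  have \<Phi>0: "\<Phi> 0 = 0" using \<Phi> by (simp add: young_function_def)
  obtain \<delta> where \<delta>: "0 < \<delta>"
    "\<And>A. A \<in> sets borel \<Longrightarrow> measure m A < \<delta> \<Longrightarrow> norm (\<nu> A) < 1 / (4 * K)"
    using ac[unfolded absolutely_continuous_vm_def, rule_format, of "1 / (4 * K)"] K by auto
  have "orlicz_norm \<Phi> \<nu> g \<le> ennreal \<epsilon>"
    if D: "D \<in> sets borel" "measure m D < \<delta>" and g: "\<And>t. cmod (g t) \<le> M * indicator D t" for g D
    unfolding orlicz_norm_def
  proof (rule SUP_least)
    fix x' :: "'x \<Rightarrow> complex" assume x': "x' \<in> dual_ball"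
    let ?\<mu> = "\<lambda>A. x' (\<nu> A)"
    let ?M = "variation_measure ?\<mu>"
    have \<mu>: "vector_measure ?\<mu>" by (rule vector_measure_functional[OF \<nu> x'])
    have small: "cmod (?\<mu> C) \<le> 1 / (4 * K)" if C: "C \<in> sets borel" "C \<subseteq> D" for C
    proof -
      have "measure m C \<le> measure m D"
        using finite_measure.finite_measure_mono[OF m(1) C(2)] D(1) m(2) by simp
      then have "norm (\<nu> C) < 1 / (4 * K)"
        using D(2) C(1) by (intro \<delta>(2)) auto
      then show ?thesis
        using dual_ballD(3)[OF x', of "\<nu> C"] by linarith
    qed
    have "emeasure ?M D \<le> ennreal (4 * (1 / (4 * K)))"
      unfolding emeasure_variation_measure[OF \<mu> D(1)] by (rule total_variation_le[OF \<mu> small])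
    then have D_le: "emeasure ?M D \<le> ennreal (1 / K)"
      by simp
    have "(\<integral>\<^sup>+t. ennreal (\<Phi> (cmod (g t) / \<epsilon>)) \<partial>?M) \<le> (\<integral>\<^sup>+t. ennreal K * indicator D t \<partial>?M)"
    proof (rule nn_integral_mono)
      fix t
      have "\<Phi> (cmod (g t) / \<epsilon>) \<le> \<Phi> (M * indicator D t / \<epsilon>)"
        using g[of t] \<epsilon> by (intro young_mono[OF \<Phi>] divide_right_mono) auto
      then show "ennreal (\<Phi> (cmod (g t) / \<epsilon>)) \<le> ennreal K * indicator D t"
        using \<Phi>0 by (cases "t \<in> D") (auto simp: K_def ennreal_leI ennreal_neg)
    qed
    also have "\<dots> = ennreal K * emeasure ?M D"
      using D(1) by (simp add: nn_integral_cmult_indicator sets_variation_measure)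
    also have "\<dots> \<le> ennreal K * ennreal (1 / K)"
      by (intro mult_left_mono D_le) simp
    also have "\<dots> = 1"
      using K by (simp flip: ennreal_mult)
    finally show "luxemburg_norm \<Phi> ?M g \<le> ennreal \<epsilon>"
      unfolding luxemburg_norm_def using \<epsilon> by (intro INF_lower) simp
  qed
  with \<delta>(1) show thesis using that by blast
qed

lemma haar_finite_measure:
  assumes "normalized_haar_measure m"
  shows "finite_measure m" "sets m = sets borel" "space m = UNIV"
proof -
  show sets: "sets m = sets borel"
    using assms by (simp add: normalized_haar_measure_def)
  show "space m = UNIV"
    using sets_eq_imp_space_eq[OF sets] by simp
  then show "finite_measure m"
    using assms by (intro finite_measureI) (simp add: normalized_haar_measure_def)
qed

text \<open>Choose an open \<open>U \<supseteq> A\<close> and a compact \<open>K \<subseteq> U\<close> with \<open>U - A\<close> and \<open>U - K\<close> small. By the tube lemma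
  \<open>s + K \<subseteq> U\<close> for \<open>s\<close> near the neutral element. A point of \<open>s + A\<close> outside \<open>A\<close> then comes from \<open>U - K\<close>
  or lies in \<open>U - A\<close>.\<close>

lemma haar_measure_translation_diff:
  fixes m :: "'g::{topological_group_add, t2_space} measure"
  assumes m: "normalized_haar_measure m" and A: "A \<in> sets borel" and \<delta>: "0 < \<delta>"
  shows "\<forall>\<^sub>F s in nhds 0. measure m ((+) s ` A - A) < \<delta>"
proof -
  interpret finite_measure m by (rule haar_finite_measure[OF m])
  note sets_m [simp] = haar_finite_measure(2)[OF m]
  have inv: "measure m ((+) s ` B) = measure m B" if "B \<in> sets borel" for s B
    using m that by (simp add: normalized_haar_measure_def measure_def)
  have outer: "emeasure m A = (INF U\<in>{U. open U \<and> A \<subseteq> U}. emeasure m U)"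
    using m A by (simp add: normalized_haar_measure_def)
  have "emeasure m A < emeasure m A + ennreal (\<delta> / 2)"
    using \<delta> by (simp add: emeasure_eq_measure ennreal_less_iff flip: ennreal_plus)
  then have "\<exists>U\<in>{U. open U \<and> A \<subseteq> U}. emeasure m U < emeasure m A + ennreal (\<delta> / 2)"
    by (subst (asm) outer) (simp only: INF_less_iff)
  then obtain U where U: "open U" "A \<subseteq> U" "measure m U < measure m A + \<delta> / 2"
    using \<delta> by (auto simp: emeasure_eq_measure ennreal_less_iff simp flip: ennreal_plus)
  have U_A: "measure m (U - A) < \<delta> / 2"
    using U A by (simp add: finite_measure_Diff)
  have "\<exists>K. compact K \<and> K \<subseteq> U \<and> measure m U < measure m K + \<delta> / 2"
  \<comment> \<open>The two cases arise because the reals are embedded into \<^typ>\<open>ennreal\<close> with negative numbers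
    truncated to zero.\<close>
  proof (cases "measure m U < \<delta> / 2")
    case True
    then show ?thesis by (intro exI[of _ "{}"]) auto
  next
    case False
    have "emeasure m U = (SUP K\<in>{K. compact K \<and> K \<subseteq> U}. emeasure m K)"
      using m U(1) unfolding normalized_haar_measure_def by blast
    moreover have "ennreal (measure m U - \<delta> / 2) < emeasure m U"
      using \<delta> False by (simp add: emeasure_eq_measure ennreal_less_iff)
    ultimately obtain K where "compact K" "K \<subseteq> U" "ennreal (measure m U - \<delta> / 2) < emeasure m K"
      by (auto simp: less_SUP_iff)
    then show ?thesis
      using False by (intro exI[of _ K]) (auto simp: emeasure_eq_measure ennreal_less_iff)
  qed
  then obtain K where K: "compact K" "K \<subseteq> U" "measure m U < measure m K + \<delta> / 2"
    by blast
  have K_borel: "K \<in> sets borel"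
    using compact_imp_closed[OF K(1)] by simp
  have U_K: "measure m (U - K) < \<delta> / 2"
    using U K K_borel by (simp add: finite_measure_Diff)
  have "open ((\<lambda>p. fst p + snd p) -` U :: ('g \<times> 'g) set)"
    by (intro open_vimage U(1) continuous_intros)
  moreover have "{0} \<times> K \<subseteq> (\<lambda>p. fst p + snd p) -` U"
    using K(2) by auto
  ultimately obtain V where V: "0 \<in> V" "open V" "V \<times> K \<subseteq> (\<lambda>p. fst p + snd p) -` U"
    using Elementary_Topology.tube_lemma[OF K(1)] by blast
  have "measure m ((+) s ` A - A) < \<delta>" if s: "s \<in> V" for s
  proof -
    have "(+) s ` A - A \<subseteq> (+) s ` (U - K) \<union> (U - A)"
    proof
      fix t assume t: "t \<in> (+) s ` A - A"
      then obtain a where a: "a \<in> A" "t = s + a" by auto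
      show "t \<in> (+) s ` (U - K) \<union> (U - A)"
      proof (cases "a \<in> K")
        case True
        then have "t \<in> U" using V(3) s a(2) by auto
        then show ?thesis using t by auto
      next
        case False
        then show ?thesis using a U(2) by auto
      qed
    qed
    then have "measure m ((+) s ` A - A) \<le> measure m ((+) s ` (U - K) \<union> (U - A))"
      using U(1) A K_borel sets_borel_translation[of "U - K" s] by (intro finite_measure_mono) auto
    also have "\<dots> \<le> measure m ((+) s ` (U - K)) + measure m (U - A)"
      using U(1) A K_borel sets_borel_translation[of "U - K" s] by (intro measure_Un_le) auto
    also have "measure m ((+) s ` (U - K)) = measure m (U - K)"
      using U(1) K_borel by (intro inv) auto
    finally show ?thesis using U_A U_K by simp
  qed
  then show ?thesis
    using V(1,2) by (auto simp: eventually_nhds)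
qed


section \<open>Continuity of translations\<close>

text \<open>If \<open>\<bar>\<phi>\<bar> \<le> M\<close>, then \<open>\<bar>\<tau>\<^sub>s \<phi> - \<phi>\<bar> \<le> 2 M\<close>, and the difference vanishes except where a point of a
  translated level set has left that level set. There are finitely many level sets, so the
  exceptional set is small.\<close>

lemma translate_simple_function_continuous:
  fixes m :: "'g::{topological_group_add, t2_space} measure"
  assumes m: "normalized_haar_measure m"
    and \<Phi>: "young_function \<Phi>" and \<nu>: "vector_measure \<nu>" and ac: "absolutely_continuous_vm \<nu> m"
    and \<phi>: "simple_function borel \<phi>" and \<epsilon>: "0 < \<epsilon>"
  shows "\<forall>\<^sub>F s in nhds 0. orlicz_norm \<Phi> \<nu> (\<lambda>t. translate s \<phi> t - \<phi> t) \<le> ennreal \<epsilon>"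
proof -
  interpret finite_measure m by (rule haar_finite_measure[OF m])
  note sets_m [simp] = haar_finite_measure(2)[OF m]
  have fin: "finite (range \<phi>)" and level: "\<And>c. \<phi> -` {c} \<in> sets borel"
    using simple_functionD[OF \<phi>] by auto
  obtain M where M: "0 < M" "\<And>t. cmod (\<phi> t) \<le> M"
    using finite_imp_bounded[OF fin] by (auto simp: bounded_pos)
  obtain \<delta> where \<delta>: "0 < \<delta>"
    "\<And>g D. D \<in> sets borel \<Longrightarrow> measure m D < \<delta> \<Longrightarrow> (\<And>t. cmod (g t) \<le> 2 * M * indicator D t) \<Longrightarrow>
      orlicz_norm \<Phi> \<nu> g \<le> ennreal \<epsilon>"
    using orlicz_norm_small_support[OF \<Phi> \<nu> ac haar_finite_measure(1,2)[OF m], of "2 * M" \<epsilon>] M(1) \<epsilon>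
    by auto
  let ?n = "card (range \<phi>)"
  have n: "0 < ?n" using fin by (simp add: card_gt_0_iff)
  have "\<forall>\<^sub>F s in nhds 0. \<forall>c\<in>range \<phi>. measure m ((+) s ` (\<phi> -` {c}) - \<phi> -` {c}) < \<delta> / ?n"
    using \<delta>(1) n
    by (intro eventually_ball_finite fin ballI haar_measure_translation_diff[OF m level]) auto
  then show ?thesis
  proof eventually_elim
    case (elim s)
    let ?B = "\<lambda>c. (+) s ` (\<phi> -` {c}) - \<phi> -` {c}"
    let ?D = "\<Union>c\<in>range \<phi>. ?B c"
    have B: "?B c \<in> sets borel" for c
      using sets_borel_translation[OF level, of s c] level by auto
    show ?case
    proof (rule \<delta>(2))
      show "?D \<in> sets borel"
        using B fin by (intro sets.finite_UN) auto
      have "measure m ?D \<le> (\<Sum>c\<in>range \<phi>. measure m (?B c))"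
        using B by (intro measure_UNION_le fin) auto
      also have "\<dots> < (\<Sum>c\<in>range \<phi>. \<delta> / ?n)"
        using elim by (intro sum_strict_mono fin) auto
      also have "\<dots> = \<delta>" using n by simp
      finally show "measure m ?D < \<delta>" .
      show "cmod (translate s \<phi> t - \<phi> t) \<le> 2 * M * indicator ?D t" for t
      proof (cases "translate s \<phi> t = \<phi> t")
        case False
        then have "t \<in> ?B (translate s \<phi> t)"
          by (auto simp: image_translation_eq_vimage translate_def)
        then have "t \<in> ?D"
          by (auto simp: translate_def)
        moreover have "cmod (translate s \<phi> t - \<phi> t) \<le> M + M"
          unfolding translate_def by (intro order_trans[OF norm_triangle_ineq4] add_mono M)
        ultimately show ?thesis by simp
      qed (use M(1) in simp)
    qed
  qed
qed

text \<open>Approximate \<open>f\<close> by a simple \<open>\<phi>\<close> and write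
  \<open>\<tau>\<^sub>s f - f = \<tau>\<^sub>s (f - \<phi>) + (\<tau>\<^sub>s \<phi> - \<phi>) + (\<phi> - f)\<close>; by invariance of the norm, the first summand is
  as small as the last, for every \<open>s\<close>.\<close>

lemma translate_continuous_at_zero:
  fixes m :: "'g::{topological_group_add, t2_space} measure"
  assumes m: "normalized_haar_measure m"
    and \<Phi>: "young_function \<Phi>" and \<nu>: "vector_measure \<nu>" and ac: "absolutely_continuous_vm \<nu> m"
    and inv: "norm_integral_translation_invariant \<nu>"
    and f: "f \<in> orlicz_space \<Phi> \<nu>" and \<epsilon>: "0 < \<epsilon>"
  shows "\<forall>\<^sub>F s in nhds 0. orlicz_norm \<Phi> \<nu> (\<lambda>t. translate s f t - f t) \<le> ennreal \<epsilon>"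
proof -
  have f_meas: "f \<in> borel_measurable borel"
    using f by (simp add: orlicz_space_def weak_orlicz_space_def)
  obtain \<phi> where \<phi>: "simple_function borel \<phi>" "orlicz_norm \<Phi> \<nu> (\<lambda>t. f t - \<phi> t) < ennreal (\<epsilon> / 3)"
    using f \<epsilon> by (fastforce simp: orlicz_space_def dest: spec[where x = "ennreal (\<epsilon> / 3)"])
  have \<phi>_meas: "\<phi> \<in> borel_measurable borel"
    by (rule borel_measurable_simple_function[OF \<phi>(1)])
  have diff_meas: "(\<lambda>t. f t - \<phi> t) \<in> borel_measurable borel"
    using f_meas \<phi>_meas by simp
  have "\<forall>\<^sub>F s in nhds 0. orlicz_norm \<Phi> \<nu> (\<lambda>t. translate s \<phi> t - \<phi> t) \<le> ennreal (\<epsilon> / 3)"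
    using \<epsilon> by (intro translate_simple_function_continuous[OF m \<Phi> \<nu> ac \<phi>(1)]) simp
  then show ?thesis
  proof eventually_elim
    case (elim s)
    let ?N = "orlicz_norm \<Phi> \<nu>"
    let ?g = "\<lambda>t. translate s \<phi> t - \<phi> t" and ?h = "\<lambda>t. \<phi> t - f t"
    have g: "?g \<in> borel_measurable borel" and h: "?h \<in> borel_measurable borel"
      using f_meas \<phi>_meas borel_measurable_translate[OF \<phi>_meas, of s] by simp_all
    have "?N (\<lambda>t. translate s f t - f t) = ?N (\<lambda>t. translate s (\<lambda>t. f t - \<phi> t) t + (?g t + ?h t))"
      by (simp add: translate_def)
    also have "\<dots> \<le> ?N (translate s (\<lambda>t. f t - \<phi> t)) + ?N (\<lambda>t. ?g t + ?h t)"
      by (intro orlicz_norm_triangle[OF \<Phi>] borel_measurable_translate diff_meas borel_measurable_add g h)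
    also have "\<dots> \<le> ?N (translate s (\<lambda>t. f t - \<phi> t)) + (?N ?g + ?N ?h)"
      by (intro add_left_mono orlicz_norm_triangle[OF \<Phi> g h])
    also have "\<dots> = ?N (\<lambda>t. f t - \<phi> t) + (?N ?g + ?N (\<lambda>t. f t - \<phi> t))"
      by (simp add: orlicz_norm_translate[OF \<Phi> \<nu> inv diff_meas] orlicz_norm_minus_commute[of \<Phi> \<nu> \<phi> f])
    also have "\<dots> \<le> ennreal (\<epsilon> / 3) + (ennreal (\<epsilon> / 3) + ennreal (\<epsilon> / 3))"
      using \<phi>(2) elim by (intro add_mono) auto
    also have "\<dots> = ennreal \<epsilon>"
      using \<epsilon> by (simp flip: ennreal_plus)
    finally show ?case .
  qed
qed

lemma vm_null_translation:
  assumes \<nu>: "vector_measure \<nu>" "norm_integral_translation_invariant \<nu>" and A: "vm_null \<nu> A"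
  shows "vm_null \<nu> ((+) s ` A)"
  unfolding vm_null_def
proof (intro conjI ballI impI)
  show "(+) s ` A \<in> sets borel"
    using A by (auto simp: vm_null_def intro: sets_borel_translation)
  fix B assume B: "B \<in> sets borel" "B \<subseteq> (+) s ` A"
  have "(+) (- s) ` B \<subseteq> A"
    using image_mono[OF B(2), of "(+) (- s)"] by (simp only: image_translation_minus)
  then have "\<nu> ((+) (- s) ` B) = 0"
    using A sets_borel_translation[OF B(1), of "- s"] by (simp add: vm_null_def)
  then show "\<nu> B = 0"
    using norm_vm_translation[OF \<nu> B(1), of "- s"] by simp
qed

theorem theorem3p6:
  fixes m :: "'g::{topological_group_add, t2_space} measure"
    and \<nu> :: "'g set \<Rightarrow> 'x::complex_banach"
    and \<Phi> :: "real \<Rightarrow> real"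
  assumes "compact (UNIV :: 'g set)"
    and "normalized_haar_measure m"
    and "young_function \<Phi>"
    and "vector_measure \<nu>"
    and "absolutely_continuous_vm \<nu> m"
    and "norm_integral_translation_invariant \<nu>"
  shows "(\<forall>f g s. f \<in> orlicz_space \<Phi> \<nu> \<and> g \<in> orlicz_space \<Phi> \<nu> \<and> vm_ae_eq \<nu> f g
            \<longrightarrow> vm_ae_eq \<nu> (translate s f) (translate s g)) \<and>
         (\<forall>f\<in>orlicz_space \<Phi> \<nu>.
            (\<forall>s. translate s f \<in> orlicz_space \<Phi> \<nu>) \<and>
            (\<forall>s. orlicz_norm \<Phi> \<nu> (translate s f) = orlicz_norm \<Phi> \<nu> f) \<and>
            (\<forall>s\<^sub>0. ((\<lambda>s. orlicz_norm \<Phi> \<nu> (\<lambda>t. translate s f t - translate s\<^sub>0 f t)) \<longlongrightarrow> 0) (at s\<^sub>0)))"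
proof -
  note m = assms(2) and \<Phi> = assms(3) and \<nu> = assms(4,6) and ac = assms(5)
  have "vm_ae_eq \<nu> (translate s f) (translate s g)" if "vm_ae_eq \<nu> f g" for f g s
  proof -
    have "{t. translate s f t \<noteq> translate s g t} = (+) s ` {t. f t \<noteq> g t}"
      by (auto simp: translate_def image_translation_eq_vimage)
    then show ?thesis
      using vm_null_translation[OF \<nu>] that by (simp add: vm_ae_eq_def)
  qed
  moreover have "(\<forall>s. translate s f \<in> orlicz_space \<Phi> \<nu>) \<and>
      (\<forall>s. orlicz_norm \<Phi> \<nu> (translate s f) = orlicz_norm \<Phi> \<nu> f) \<and>
      (\<forall>s\<^sub>0. ((\<lambda>s. orlicz_norm \<Phi> \<nu> (\<lambda>t. translate s f t - translate s\<^sub>0 f t)) \<longlongrightarrow> 0) (at s\<^sub>0))"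
    if f: "f \<in> orlicz_space \<Phi> \<nu>" for f
  proof (intro conjI allI)
    have f_meas: "f \<in> borel_measurable borel"
      using f by (simp add: orlicz_space_def weak_orlicz_space_def)
    show norm_eq: "orlicz_norm \<Phi> \<nu> (translate s f) = orlicz_norm \<Phi> \<nu> f" for s
      by (rule orlicz_norm_translate[OF \<Phi> \<nu> f_meas])
    show "translate s f \<in> orlicz_space \<Phi> \<nu>" for s
      unfolding orlicz_space_def
    proof (intro CollectI conjI allI impI)
      show "translate s f \<in> weak_orlicz_space \<Phi> \<nu>"
        using f norm_eq[of s] borel_measurable_translate[OF f_meas]
        by (simp add: orlicz_space_def weak_orlicz_space_def)
      fix \<epsilon> :: ennreal assume "0 < \<epsilon>"
      then obtain \<phi> where \<phi>: "simple_function borel \<phi>" "orlicz_norm \<Phi> \<nu> (\<lambda>t. f t - \<phi> t) < \<epsilon>"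
        using f by (auto simp: orlicz_space_def)
      have "(\<lambda>t. f t - \<phi> t) \<in> borel_measurable borel"
        using f_meas borel_measurable_simple_function[OF \<phi>(1)] by simp
      then have "orlicz_norm \<Phi> \<nu> (translate s (\<lambda>t. f t - \<phi> t)) < \<epsilon>"
        using \<phi>(2) by (simp add: orlicz_norm_translate[OF \<Phi> \<nu>])
      then show "\<exists>\<phi>. simple_function borel \<phi> \<and> orlicz_norm \<Phi> \<nu> (\<lambda>t. translate s f t - \<phi> t) < \<epsilon>"
        using simple_function_translate[OF \<phi>(1), of s] unfolding translate_def by blast
    qed
    fix s\<^sub>0
    \<comment> \<open>Invariance of the norm reduces continuity at \<open>s\<^sub>0\<close> to continuity at the neutral element.\<close>
    have shift: "orlicz_norm \<Phi> \<nu> (\<lambda>t. translate s f t - translate s\<^sub>0 f t)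
        = orlicz_norm \<Phi> \<nu> (\<lambda>t. translate (- s\<^sub>0 + s) f t - f t)" for s
    proof -
      have "translate s\<^sub>0 (\<lambda>t. translate (- s\<^sub>0 + s) f t - f t)
          = (\<lambda>t. translate s\<^sub>0 (translate (- s\<^sub>0 + s) f) t - translate s\<^sub>0 f t)"
        by (simp add: translate_def)
      also have "\<dots> = (\<lambda>t. translate s f t - translate s\<^sub>0 f t)"
        by (simp add: translate_translate flip: add.assoc)
      finally show ?thesis
        using orlicz_norm_translate[OF \<Phi> \<nu>, of "\<lambda>t. translate (- s\<^sub>0 + s) f t - f t" s\<^sub>0]
          f_meas borel_measurable_translate[OF f_meas, of "- s\<^sub>0 + s"] by simp
    qed
    have lim: "((\<lambda>s. - s\<^sub>0 + s) \<longlongrightarrow> 0) (at s\<^sub>0)"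
      by (auto intro!: tendsto_eq_intros)
    show "((\<lambda>s. orlicz_norm \<Phi> \<nu> (\<lambda>t. translate s f t - translate s\<^sub>0 f t)) \<longlongrightarrow> 0) (at s\<^sub>0)"
    proof (rule order_tendstoI)
      fix e :: ennreal assume "0 < e"
      then obtain \<epsilon> where \<epsilon>: "0 < \<epsilon>" "ennreal \<epsilon> < e"
        using dense[of 0 e] by (metis ennreal_cases ennreal_less_zero_iff less_top order_less_trans top.not_eq_extremum)
      have "\<forall>\<^sub>F r in nhds 0. orlicz_norm \<Phi> \<nu> (\<lambda>t. translate r f t - f t) \<le> ennreal \<epsilon>"
        by (rule translate_continuous_at_zero[OF m \<Phi> \<nu>(1) ac \<nu>(2) f \<epsilon>(1)])
      from eventually_compose_filterlim[OF this lim]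
      show "\<forall>\<^sub>F s in at s\<^sub>0. orlicz_norm \<Phi> \<nu> (\<lambda>t. translate s f t - translate s\<^sub>0 f t) < e"
        unfolding shift by eventually_elim (use \<epsilon>(2) in simp)
    qed simp
  qed
  ultimately show ?thesis by blast
qed

end
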